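(* Let $G$ be a finite simple undirected graph and let $K_1,K_2$ be nonempty induced subgraphs of $G$ with $V(G)=V(K_1)\cup V(K_2)$ and $V(K_1)\cap V(K_2)=\emptyset$. Suppose there are vertices $a\in V(K_1)$ and $b\in V(K_2)$ such that $\{a,b\}\in E(G)$, every vertex of $K_1$ is adjacent to $b$, and every vertex of $K_2$ is adjacent to $a$. Then $\mathcal{H}^{\mathrm{Path}}_n(G)\cong\mathcal{H}^{\mathrm{Cube}}_n(G)\cong(0)$ for all $n>0$.
   Context: $R$ is a commutative ring with unit; graphs are finite, simple and undirected. A graph homomorphism is a vertex map sending adjacent vertices to equal or adjacent vertices. $Q_n$ is the graph on $\{0,1\}^n$ with edges between vertices at Hamming distance one ($Q_0$ a single vertex). Discrete cubical homology $\mathcal{H}^{\mathrm{Cube}}_\bullet(G)$: a singular $n$-cube is a graph homomorphism $\sigma: Q_n\to G$; $\mathcal{L}^{\mathrm{Cube}}_n(G)$ is the free $R$-module on them. For $n\ge1$, $i\in[n]$: $f_i^{\pm}\sigma(a_1,\dots,a_{n-1})=\sigma(a_1,\dots,a_{i-1},\epsilon,a_i,\dots,a_{n-1})$ with $\epsilon=1$ for $+$, $\epsilon=0$ for $-$. $\sigma$ is degenerate if $f_i^+\sigma=f_i^-\sigma$ for some $i$. $\mathcal{C}^{\mathrm{Cube}}_n(G)$ is $\mathcal{L}^{\mathrm{Cube}}_n(G)$ modulo degenerate cubes, with $\partial_n\sigma=\sum_{i=1}^n(-1)^i(f_i^-\sigma-f_i^+\sigma)$, $\partial_0=0$; $\mathcal{H}^{\mathrm{Cube}}_n(G)$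 is its homology. Path homology $\mathcal{H}^{\mathrm{Path}}_\bullet(G)$: $\mathcal{C}_n(V)$ is the free $R$-module on $(n+1)$-tuples of vertices modulo tuples with $v_i=v_{i+1}$ for some $i$, with $\partial_n(v_0,\dots,v_n)=\sum_{i=0}^n(-1)^i(v_0,\dots,\widehat{v_i},\dots,v_n)$, $\partial_0=0$. $\widetilde{\mathcal{C}}_n(G)\subseteq\mathcal{C}_n(V)$ is generated by allowed paths (tuples with $\{v_i,v_{i+1}\}\in E(G)$ for all $i$), $\widetilde{\mathcal{C}}_{-1}=0$; $\mathcal{C}^{\mathrm{Path}}_n(G)=\{x\in\widetilde{\mathcal{C}}_n(G):\partial_nx\in\widetilde{\mathcal{C}}_{n-1}(G)\}$ and $\mathcal{H}^{\mathrm{Path}}_n(G)$ is its homology. *)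

theory Defs
  imports "HOL-Algebra.Module" "HOL-Algebra.QuotRing"
begin

section \<open>Graphs\<close>

record 'v sgraph =
  vertices :: "'v set"
  edges :: "'v set set"

definition finite_simple_graph :: "'v sgraph \<Rightarrow> bool" where
  "finite_simple_graph G \<longleftrightarrow>
     finite (vertices G) \<and> (\<forall>e\<in>edges G. e \<subseteq> vertices G \<and> card e = 2)"

definition induced_subgraph :: "'v sgraph \<Rightarrow> 'v sgraph \<Rightarrow> bool" where
  "induced_subgraph K G \<longleftrightarrow>
     vertices K \<subseteq> vertices G \<and> edges K = {e \<in> edges G. e \<subseteq> vertices K}"

text \<open>Homomorphisms are extensional functions, so that two of them are equal as HOL functions
  exactly when they agree on the vertices of the source graph.\<close>

definition graph_hom :: "'u sgraph \<Rightarrow> 'v sgraph \<Rightarrow> ('u \<Rightarrow> 'v) set" where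
  "graph_hom G H =
     {f \<in> vertices G \<rightarrow>\<^sub>E vertices H. \<forall>u v. {u, v} \<in> edges G \<longrightarrow> f u = f v \<or> {f u, f v} \<in> edges H}"


section \<open>Modules\<close>

text \<open>The fields \<^const>\<open>mult\<close> and \<^const>\<open>one\<close> that the record of modules inherits from that of
  rings play no role for modules; they are left unspecified.\<close>

text \<open>A formal linear combination of elements of \<open>S\<close> is its coefficient function, which is
  \<open>\<zero>\<close> outside a finite subset of \<open>S\<close>.\<close>

definition free_module :: "('r, 'k) ring_scheme \<Rightarrow> 'x set \<Rightarrow> ('r, 'x \<Rightarrow> 'r) module" where
  "free_module R S =
     \<lparr>carrier = {c. (\<forall>x. c x \<in> carrier R) \<and> (\<forall>x. x \<notin> S \<longrightarrow> c x = \<zero>\<^bsub>R\<^esub>) \<and> finite {x. c x \<noteq> \<zero>\<^bsub>R\<^esub>}},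
      mult = undefined, one = undefined,
      zero = (\<lambda>_. \<zero>\<^bsub>R\<^esub>), add = (\<lambda>c d x. c x \<oplus>\<^bsub>R\<^esub> d x),
      smult = (\<lambda>r c x. r \<otimes>\<^bsub>R\<^esub> c x)\<rparr>"

lemma free_module_is_module: assumes "cring R" shows "module R (free_module R S)"
proof -
  interpret cring R by fact
  show ?thesis
  proof (rule moduleI)
    show "abelian_group (free_module R S)"
    proof (rule abelian_groupI)
      fix c d assume "c \<in> carrier (free_module R S)" "d \<in> carrier (free_module R S)"
      then show "c \<oplus>\<^bsub>free_module R S\<^esub> d \<in> carrier (free_module R S)"
        using finite_subset[of "{x. c x \<oplus>\<^bsub>R\<^esub> d x \<noteq> \<zero>\<^bsub>R\<^esub>}"
            "{x. c x \<noteq> \<zero>\<^bsub>R\<^esub>} \<union> {x. d x \<noteq> \<zero>\<^bsub>R\<^esub>}"]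
        by (force simp: free_module_def)
    next
      fix c assume c: "c \<in> carrier (free_module R S)"
      show "\<exists>y\<in>carrier (free_module R S). y \<oplus>\<^bsub>free_module R S\<^esub> c = \<zero>\<^bsub>free_module R S\<^esub>"
        apply (rule bexI[of _ "\<lambda>x. \<ominus>\<^bsub>R\<^esub> c x"])
        using c by (auto simp: free_module_def l_neg)
    next
      fix c d e
      assume "c \<in> carrier (free_module R S)" "d \<in> carrier (free_module R S)"
        "e \<in> carrier (free_module R S)"
      then show "c \<oplus>\<^bsub>free_module R S\<^esub> d \<oplus>\<^bsub>free_module R S\<^esub> e
          = c \<oplus>\<^bsub>free_module R S\<^esub> (d \<oplus>\<^bsub>free_module R S\<^esub> e)"
        by (simp add: free_module_def a_assoc)
    next
      fix c d
      assume "c \<in> carrier (free_module R S)" "d \<in> carrier (free_module R S)"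
      then show "c \<oplus>\<^bsub>free_module R S\<^esub> d = d \<oplus>\<^bsub>free_module R S\<^esub> c"
        by (simp add: free_module_def fun_eq_iff a_comm)
    qed (simp_all add: free_module_def)
  next
    fix r c assume "r \<in> carrier R" "c \<in> carrier (free_module R S)"
    then show "r \<odot>\<^bsub>free_module R S\<^esub> c \<in> carrier (free_module R S)"
      using finite_subset[of "{x. r \<otimes>\<^bsub>R\<^esub> c x \<noteq> \<zero>\<^bsub>R\<^esub>}" "{x. c x \<noteq> \<zero>\<^bsub>R\<^esub>}"]
      by (force simp: free_module_def)
  qed (simp_all add: free_module_def l_distr r_distr m_assoc is_cring)
qed

definition basis_elem :: "('r, 'k) ring_scheme \<Rightarrow> 'x \<Rightarrow> 'x \<Rightarrow> 'r" where
  "basis_elem R x = (\<lambda>y. if y = x then \<one>\<^bsub>R\<^esub> else \<zero>\<^bsub>R\<^esub>)"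

lemma basis_elem_closed:
  assumes "cring R" "x \<in> S" shows "basis_elem R x \<in> carrier (free_module R S)"
proof -
  interpret cring R by fact
  show ?thesis using assms(2) by (auto simp: free_module_def basis_elem_def)
qed

definition linear_extension ::
  "('r, 'k) ring_scheme \<Rightarrow> ('r, 'm) module \<Rightarrow> ('x \<Rightarrow> 'm) \<Rightarrow> ('x \<Rightarrow> 'r) \<Rightarrow> 'm" where
  "linear_extension R M f c = (\<Oplus>\<^bsub>M\<^esub>x\<in>{x. c x \<noteq> \<zero>\<^bsub>R\<^esub>}. c x \<odot>\<^bsub>M\<^esub> f x)"

definition generated_submodule ::
  "('r, 'k) ring_scheme \<Rightarrow> ('r, 'm) module \<Rightarrow> 'm set \<Rightarrow> 'm set" where
  "generated_submodule R M X = \<Inter>{N. submodule N R M \<and> X \<subseteq> N}"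

text \<open>The quotient of \<open>M\<close> by a submodule \<open>N\<close>. As in \<^const>\<open>FactRing\<close> and \<^const>\<open>rcoset_mult\<close>,
  operations on cosets are unions over representatives; each union is a single coset.\<close>

definition quotient_module :: "('r, 'm) module \<Rightarrow> 'm set \<Rightarrow> ('r, 'm set) module" where
  "quotient_module M N =
     \<lparr>carrier = a_rcosets\<^bsub>M\<^esub> N, mult = undefined, one = undefined,
      zero = N, add = set_add M,
      smult = (\<lambda>r X. \<Union>x\<in>X. N +>\<^bsub>M\<^esub> (r \<odot>\<^bsub>M\<^esub> x))\<rparr>"

lemma quotient_smult_coset:
  assumes "module R M" "submodule N R M" "r \<in> carrier R" "x \<in> carrier M"
  shows "r \<odot>\<^bsub>quotient_module M N\<^esub> (N +>\<^bsub>M\<^esub> x) = N +>\<^bsub>M\<^esub> (r \<odot>\<^bsub>M\<^esub> x)"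
proof -
  interpret module R M by fact
  interpret N: submodule N R M by fact
  interpret A: abelian_subgroup N M
    by (rule abelian_subgroupI3) (auto simp: additive_subgroup_def N.subgroup_axioms M.abelian_group_axioms)
  have sub: "N \<subseteq> carrier M" using submoduleE[OF assms(2)] by auto
  have "N +>\<^bsub>M\<^esub> (r \<odot>\<^bsub>M\<^esub> y) = N +>\<^bsub>M\<^esub> (r \<odot>\<^bsub>M\<^esub> x)" if y: "y \<in> N +>\<^bsub>M\<^esub> x" for y
  proof -
    obtain h where h: "h \<in> N" "y = h \<oplus>\<^bsub>M\<^esub> x" using y by (auto simp: a_r_coset_def r_coset_def)
    have hc: "h \<in> carrier M" using h sub by auto
    have "r \<odot>\<^bsub>M\<^esub> y = (r \<odot>\<^bsub>M\<^esub> h) \<oplus>\<^bsub>M\<^esub> (r \<odot>\<^bsub>M\<^esub> x)" using h hc assms by (simp add: smult_r_distr)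
    moreover have "r \<odot>\<^bsub>M\<^esub> h \<in> N" using assms(3) h by auto
    ultimately have "r \<odot>\<^bsub>M\<^esub> y \<in> N +>\<^bsub>M\<^esub> (r \<odot>\<^bsub>M\<^esub> x)" using h by (auto simp: a_r_coset_def r_coset_def)
    then show ?thesis using A.a_repr_independence' smult_closed[OF assms(3,4)] by simp
  qed
  moreover have "x \<in> N +>\<^bsub>M\<^esub> x" using A.a_rcos_self assms(4) by auto
  ultimately have "(\<Union>y\<in>N +>\<^bsub>M\<^esub> x. N +>\<^bsub>M\<^esub> (r \<odot>\<^bsub>M\<^esub> y)) = N +>\<^bsub>M\<^esub> (r \<odot>\<^bsub>M\<^esub> x)"
    by blast
  then show ?thesis by (simp add: quotient_module_def)
qed

lemma quotient_module_is_module: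
  assumes "module R M" "submodule N R M"
  shows "module R (quotient_module M N)"
proof -
  interpret module R M by fact
  interpret N: submodule N R M by fact
  interpret A: abelian_subgroup N M
    by (rule abelian_subgroupI3) (auto simp: additive_subgroup_def N.subgroup_axioms M.abelian_group_axioms)
  have car: "X \<in> carrier (quotient_module M N) \<longleftrightarrow> (\<exists>x\<in>carrier M. X = N +>\<^bsub>M\<^esub> x)" for X
    by (auto simp: quotient_module_def A_RCOSETS_def RCOSETS_def a_r_coset_def)
  have add: "(N +>\<^bsub>M\<^esub> x) \<oplus>\<^bsub>quotient_module M N\<^esub> (N +>\<^bsub>M\<^esub> y) = N +>\<^bsub>M\<^esub> (x \<oplus>\<^bsub>M\<^esub> y)"
    if "x \<in> carrier M" "y \<in> carrier M" for x y
    using that by (simp add: quotient_module_def A.a_rcos_sum)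
  have cl: "N +>\<^bsub>M\<^esub> x \<in> carrier (quotient_module M N)" if "x \<in> carrier M" for x
    using that car by blast
  note sm = quotient_smult_coset[OF assms]
  have zero: "\<zero>\<^bsub>quotient_module M N\<^esub> = N +>\<^bsub>M\<^esub> \<zero>\<^bsub>M\<^esub>"
    using submoduleE[OF assms(2)] by (simp add: quotient_module_def M.a_coset_add_zero)
  have ag: "abelian_group (quotient_module M N)"
  proof (rule abelian_groupI)
    fix X Y assume "X \<in> carrier (quotient_module M N)" "Y \<in> carrier (quotient_module M N)"
    then obtain x y where xy: "x \<in> carrier M" "X = N +>\<^bsub>M\<^esub> x" "y \<in> carrier M" "Y = N +>\<^bsub>M\<^esub> y"
      using car by metis
    show "X \<oplus>\<^bsub>quotient_module M N\<^esub> Y \<in> carrier (quotient_module M N)"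
      by (simp add: xy add cl)
    show "X \<oplus>\<^bsub>quotient_module M N\<^esub> Y = Y \<oplus>\<^bsub>quotient_module M N\<^esub> X"
      by (simp add: xy add M.a_comm)
  next
    fix X Y Z assume "X \<in> carrier (quotient_module M N)" "Y \<in> carrier (quotient_module M N)"
      "Z \<in> carrier (quotient_module M N)"
    then obtain x y z where xyz: "x \<in> carrier M" "X = N +>\<^bsub>M\<^esub> x" "y \<in> carrier M" "Y = N +>\<^bsub>M\<^esub> y"
      "z \<in> carrier M" "Z = N +>\<^bsub>M\<^esub> z"
      using car by metis
    show "X \<oplus>\<^bsub>quotient_module M N\<^esub> Y \<oplus>\<^bsub>quotient_module M N\<^esub> Z
        = X \<oplus>\<^bsub>quotient_module M N\<^esub> (Y \<oplus>\<^bsub>quotient_module M N\<^esub> Z)"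
      by (simp add: xyz add M.a_assoc)
  next
    fix X assume "X \<in> carrier (quotient_module M N)"
    then obtain x where x: "x \<in> carrier M" "X = N +>\<^bsub>M\<^esub> x" using car by metis
    show "\<zero>\<^bsub>quotient_module M N\<^esub> \<oplus>\<^bsub>quotient_module M N\<^esub> X = X"
      by (simp add: x zero add)
    show "\<exists>Y\<in>carrier (quotient_module M N). Y \<oplus>\<^bsub>quotient_module M N\<^esub> X = \<zero>\<^bsub>quotient_module M N\<^esub>"
      by (rule bexI[of _ "N +>\<^bsub>M\<^esub> (\<ominus>\<^bsub>M\<^esub> x)"]) (simp_all add: x add zero cl M.l_neg)
  qed (simp add: zero cl)
  show ?thesis
  proof (rule moduleI[OF R.cring_axioms ag])
    fix r X assume r: "r \<in> carrier R" and "X \<in> carrier (quotient_module M N)"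
    then obtain x where x: "x \<in> carrier M" "X = N +>\<^bsub>M\<^esub> x" using car by metis
    show "r \<odot>\<^bsub>quotient_module M N\<^esub> X \<in> carrier (quotient_module M N)"
      by (simp add: x sm cl r)
  next
    fix r s X assume rs: "r \<in> carrier R" "s \<in> carrier R" and "X \<in> carrier (quotient_module M N)"
    then obtain x where x: "x \<in> carrier M" "X = N +>\<^bsub>M\<^esub> x" using car by metis
    show "(r \<oplus>\<^bsub>R\<^esub> s) \<odot>\<^bsub>quotient_module M N\<^esub> X = r \<odot>\<^bsub>quotient_module M N\<^esub> X \<oplus>\<^bsub>quotient_module M N\<^esub> s \<odot>\<^bsub>quotient_module M N\<^esub> X"
      by (simp add: x sm add rs smult_l_distr)
    show "(r \<otimes>\<^bsub>R\<^esub> s) \<odot>\<^bsub>quotient_module M N\<^esub> X = r \<odot>\<^bsub>quotient_module M N\<^esub> (s \<odot>\<^bsub>quotient_module M N\<^esub> X)"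
      by (simp add: x sm rs smult_assoc1)
  next
    fix X assume "X \<in> carrier (quotient_module M N)"
    then obtain x where x: "x \<in> carrier M" "X = N +>\<^bsub>M\<^esub> x" using car by metis
    show "\<one>\<^bsub>R\<^esub> \<odot>\<^bsub>quotient_module M N\<^esub> X = X"
      by (simp add: x sm)
  next
    fix r X Y assume r: "r \<in> carrier R"
      and XY: "X \<in> carrier (quotient_module M N)" "Y \<in> carrier (quotient_module M N)"
    from XY(1) obtain x where x: "x \<in> carrier M" "X = N +>\<^bsub>M\<^esub> x" using car by metis
    from XY(2) obtain y where y: "y \<in> carrier M" "Y = N +>\<^bsub>M\<^esub> y" using car by metis
    show "r \<odot>\<^bsub>quotient_module M N\<^esub> (X \<oplus>\<^bsub>quotient_module M N\<^esub> Y) = r \<odot>\<^bsub>quotient_module M N\<^esub> X \<oplus>\<^bsub>quotient_module M N\<^esub> r \<odot>\<^bsub>quotient_module M N\<^esub> Y"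
      by (simp add: x y sm add r smult_r_distr)
  qed
qed

text \<open>The map into the quotient of \<open>M'\<close> by \<open>N'\<close> induced by a linear map \<open>f\<close> into \<open>M'\<close>, as a
  function of cosets.\<close>

definition induced_map ::
  "('r, 'm) module \<Rightarrow> 'm set \<Rightarrow> ('l \<Rightarrow> 'm) \<Rightarrow> 'l set \<Rightarrow> 'm set" where
  "induced_map M' N' f X = (\<Union>x\<in>X. N' +>\<^bsub>M'\<^esub> f x)"

definition module_iso ::
  "('r, 'k) ring_scheme \<Rightarrow> ('r, 'm) module \<Rightarrow> ('r, 'l) module \<Rightarrow> bool" where
  "module_iso R M N \<longleftrightarrow>
     (\<exists>\<phi> \<in> iso (add_monoid M) (add_monoid N).
        \<forall>r\<in>carrier R. \<forall>x\<in>carrier M. \<phi> (r \<odot>\<^bsub>M\<^esub> x) = r \<odot>\<^bsub>N\<^esub> \<phi> x)"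

definition zero_module :: "('r, unit) module" where
  "zero_module =
     \<lparr>carrier = {()}, mult = undefined, one = undefined, zero = (), add = (\<lambda>_ _. ()),
      smult = (\<lambda>_ _. ())\<rparr>"

definition sign :: "('r, 'k) ring_scheme \<Rightarrow> nat \<Rightarrow> 'r" where
  "sign R i = (\<ominus>\<^bsub>R\<^esub> \<one>\<^bsub>R\<^esub>) [^]\<^bsub>R\<^esub> i"

text \<open>Homology of \<open>\<dots> \<rightarrow> C 1 \<rightarrow> C 0\<close>, where \<open>d n\<close> maps \<open>C n\<close> to \<open>C (n - 1)\<close>. Since \<open>0 - 1 = 0\<close> on
  natural numbers, \<open>d 0\<close> formally takes values in \<open>C 0\<close>; below it is always the zero map.\<close>

definition homology ::
  "(nat \<Rightarrow> ('r, 'm) module) \<Rightarrow> (nat \<Rightarrow> 'm \<Rightarrow> 'm) \<Rightarrow> nat \<Rightarrow> ('r, 'm set) module" where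
  "homology C d n =
     quotient_module
       ((C n)\<lparr>carrier := {x \<in> carrier (C n). d n x = \<zero>\<^bsub>C (n - 1)\<^esub>}\<rparr>)
       (d (Suc n) ` carrier (C (Suc n)))"


section \<open>Discrete cubical homology\<close>

text \<open>Points of \<open>{0,1}\<^sup>n\<close> are Boolean lists of length \<open>n\<close>, with \<^const>\<open>True\<close> for 1.\<close>

definition hypercube :: "nat \<Rightarrow> bool list sgraph" where
  "hypercube n =
     \<lparr>vertices = {a. length a = n},
      edges = {{a, b} |a b. length a = n \<and> length b = n \<and> card {i. i < n \<and> a ! i \<noteq> b ! i} = 1}\<rparr>"

definition singular_cubes :: "'v sgraph \<Rightarrow> nat \<Rightarrow> (bool list \<Rightarrow> 'v) set" where
  "singular_cubes G n = graph_hom (hypercube n) G"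

text \<open>\<open>cube_face n i \<epsilon>\<close> is \<open>f\<^sub>i\<^sup>+\<close> on \<open>n\<close>-cubes if \<open>\<epsilon>\<close> is \<^const>\<open>True\<close>, and \<open>f\<^sub>i\<^sup>-\<close> otherwise;
  \<open>i\<close> ranges over \<open>{1..n}\<close>.\<close>

definition cube_face ::
  "nat \<Rightarrow> nat \<Rightarrow> bool \<Rightarrow> (bool list \<Rightarrow> 'v) \<Rightarrow> bool list \<Rightarrow> 'v" where
  "cube_face n i \<epsilon> \<sigma> =
     restrict (\<lambda>a. \<sigma> (take (i - 1) a @ \<epsilon> # drop (i - 1) a)) (vertices (hypercube (n - 1)))"

definition degenerate_cubes :: "'v sgraph \<Rightarrow> nat \<Rightarrow> (bool list \<Rightarrow> 'v) set" where
  "degenerate_cubes G n =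
     {\<sigma> \<in> singular_cubes G n. \<exists>i\<in>{1..n}. cube_face n i True \<sigma> = cube_face n i False \<sigma>}"

definition free_cubes ::
  "('r, 'k) ring_scheme \<Rightarrow> 'v sgraph \<Rightarrow> nat \<Rightarrow> ('r, (bool list \<Rightarrow> 'v) \<Rightarrow> 'r) module" where
  "free_cubes R G n = free_module R (singular_cubes G n)"

definition degenerate_cube_chains ::
  "('r, 'k) ring_scheme \<Rightarrow> 'v sgraph \<Rightarrow> nat \<Rightarrow> ((bool list \<Rightarrow> 'v) \<Rightarrow> 'r) set" where
  "degenerate_cube_chains R G n =
     generated_submodule R (free_cubes R G n) (basis_elem R ` degenerate_cubes G n)"

definition cube_chains ::
  "('r, 'k) ring_scheme \<Rightarrow> 'v sgraph \<Rightarrow> nat \<Rightarrow> ('r, ((bool list \<Rightarrow> 'v) \<Rightarrow> 'r) set) module" where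
  "cube_chains R G n = quotient_module (free_cubes R G n) (degenerate_cube_chains R G n)"

definition cube_boundary_basis ::
  "('r, 'k) ring_scheme \<Rightarrow> 'v sgraph \<Rightarrow> nat \<Rightarrow> (bool list \<Rightarrow> 'v) \<Rightarrow> (bool list \<Rightarrow> 'v) \<Rightarrow> 'r" where
  "cube_boundary_basis R G n \<sigma> =
     (let L = free_cubes R G (n - 1) in
      \<Oplus>\<^bsub>L\<^esub>i\<in>{1..n}. sign R i \<odot>\<^bsub>L\<^esub>
        (basis_elem R (cube_face n i False \<sigma>) \<ominus>\<^bsub>L\<^esub> basis_elem R (cube_face n i True \<sigma>)))"

definition cube_boundary ::
  "('r, 'k) ring_scheme \<Rightarrow> 'v sgraph \<Rightarrow> nat \<Rightarrow>
     ((bool list \<Rightarrow> 'v) \<Rightarrow> 'r) set \<Rightarrow> ((bool list \<Rightarrow> 'v) \<Rightarrow> 'r) set" where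
  "cube_boundary R G n =
     (if n = 0 then (\<lambda>_. \<zero>\<^bsub>cube_chains R G (n - 1)\<^esub>)
      else induced_map (free_cubes R G (n - 1)) (degenerate_cube_chains R G (n - 1))
             (linear_extension R (free_cubes R G (n - 1)) (cube_boundary_basis R G n)))"

definition cube_homology ::
  "('r, 'k) ring_scheme \<Rightarrow> 'v sgraph \<Rightarrow> nat \<Rightarrow> ('r, ((bool list \<Rightarrow> 'v) \<Rightarrow> 'r) set set) module" where
  "cube_homology R G = homology (cube_chains R G) (cube_boundary R G)"


section \<open>Path homology\<close>

definition tuples :: "'v set \<Rightarrow> nat \<Rightarrow> 'v list set" where
  "tuples V n = {p. length p = n + 1 \<and> set p \<subseteq> V}"

definition degenerate_tuples :: "'v set \<Rightarrow> nat \<Rightarrow> 'v list set" where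
  "degenerate_tuples V n = {p \<in> tuples V n. \<exists>i<n. p ! i = p ! Suc i}"

definition free_tuples ::
  "('r, 'k) ring_scheme \<Rightarrow> 'v set \<Rightarrow> nat \<Rightarrow> ('r, 'v list \<Rightarrow> 'r) module" where
  "free_tuples R V n = free_module R (tuples V n)"

definition degenerate_tuple_chains ::
  "('r, 'k) ring_scheme \<Rightarrow> 'v set \<Rightarrow> nat \<Rightarrow> ('v list \<Rightarrow> 'r) set" where
  "degenerate_tuple_chains R V n =
     generated_submodule R (free_tuples R V n) (basis_elem R ` degenerate_tuples V n)"

definition tuple_chains ::
  "('r, 'k) ring_scheme \<Rightarrow> 'v set \<Rightarrow> nat \<Rightarrow> ('r, ('v list \<Rightarrow> 'r) set) module" where
  "tuple_chains R V n = quotient_module (free_tuples R V n) (degenerate_tuple_chains R V n)"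

text \<open>The class of a tuple in \<^const>\<open>tuple_chains\<close>.\<close>

definition tuple_class ::
  "('r, 'k) ring_scheme \<Rightarrow> 'v set \<Rightarrow> nat \<Rightarrow> 'v list \<Rightarrow> ('v list \<Rightarrow> 'r) set" where
  "tuple_class R V n p = degenerate_tuple_chains R V n +>\<^bsub>free_tuples R V n\<^esub> basis_elem R p"

definition tuple_boundary_basis ::
  "('r, 'k) ring_scheme \<Rightarrow> 'v set \<Rightarrow> nat \<Rightarrow> 'v list \<Rightarrow> 'v list \<Rightarrow> 'r" where
  "tuple_boundary_basis R V n p =
     (let L = free_tuples R V (n - 1) in
      \<Oplus>\<^bsub>L\<^esub>i\<in>{0..n}. sign R i \<odot>\<^bsub>L\<^esub> basis_elem R (take i p @ drop (Suc i) p))"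

definition tuple_boundary ::
  "('r, 'k) ring_scheme \<Rightarrow> 'v set \<Rightarrow> nat \<Rightarrow> ('v list \<Rightarrow> 'r) set \<Rightarrow> ('v list \<Rightarrow> 'r) set" where
  "tuple_boundary R V n =
     (if n = 0 then (\<lambda>_. \<zero>\<^bsub>tuple_chains R V (n - 1)\<^esub>)
      else induced_map (free_tuples R V (n - 1)) (degenerate_tuple_chains R V (n - 1))
             (linear_extension R (free_tuples R V (n - 1)) (tuple_boundary_basis R V n)))"

definition allowed_paths :: "'v sgraph \<Rightarrow> nat \<Rightarrow> 'v list set" where
  "allowed_paths G n = {p \<in> tuples (vertices G) n. \<forall>i<n. {p ! i, p ! Suc i} \<in> edges G}"

definition allowed_chains ::
  "('r, 'k) ring_scheme \<Rightarrow> 'v sgraph \<Rightarrow> nat \<Rightarrow> ('v list \<Rightarrow> 'r) set set" where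
  "allowed_chains R G n =
     generated_submodule R (tuple_chains R (vertices G) n)
       (tuple_class R (vertices G) n ` allowed_paths G n)"

text \<open>The case distinction expresses that there are no nonzero allowed chains in degree \<open>-1\<close>.\<close>

definition path_chains ::
  "('r, 'k) ring_scheme \<Rightarrow> 'v sgraph \<Rightarrow> nat \<Rightarrow> ('r, ('v list \<Rightarrow> 'r) set) module" where
  "path_chains R G n =
     (tuple_chains R (vertices G) n)
       \<lparr>carrier := {x \<in> allowed_chains R G n. tuple_boundary R (vertices G) n x \<in>
          (if n = 0 then {\<zero>\<^bsub>tuple_chains R (vertices G) (n - 1)\<^esub>} else allowed_chains R G (n - 1))}\<rparr>"

definition path_homology ::
  "('r, 'k) ring_scheme \<Rightarrow> 'v sgraph \<Rightarrow> nat \<Rightarrow> ('r, ('v list \<Rightarrow> 'r) set set) module" where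
  "path_homology R G = homology (path_chains R G) (tuple_boundary R (vertices G))"

end

theory Submission
  imports Defs "HOL-Library.Poly_Mapping"
begin

text \<open>Let \<open>f\<close> send \<open>K\<^sub>1\<close> to \<open>b\<close> and \<open>K\<^sub>2\<close> to \<open>a\<close>. This is a graph map since \<open>{a, b}\<close> is an edge, every vertex
  \<open>v\<close> is adjacent to \<open>f v\<close>, and \<open>f v\<close> is equal or adjacent to \<open>b\<close>. Hence \<open>G\<close> contracts to \<open>b\<close> by two one-step
  homotopies, from the identity to \<open>f\<close> and from \<open>f\<close> to the constant map. The sum \<open>T\<close> of the two prism
  operators satisfies \<open>\<partial> T + T \<partial> = - id\<close> in positive degrees, as constant cubes and constant tuples are
  degenerate there. On paths, \<open>T\<close> preserves the allowed chains up to degenerate tuples, because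
  consecutive entries of the prisms over an allowed path are equal or adjacent.\<close>

section \<open>Linear maps and free modules\<close>

text \<open>Two steps are needed because a vertex of \<open>K2\<close> need be neither equal nor
  adjacent to \<open>b\<close>, so the identity and the constant map are in general not one step
  apart. Passing through \<open>f\<close>, whose only values are \<open>a\<close> and
  \<open>b\<close>, repairs this. The two prism identities telescope,
  \<open>(f - id) + (b - f) = b - id\<close>, which explains the sign in \<open>- id\<close>. The
  obstacle on the path side is that deleting an inner vertex of an allowed path may leave a tuple
  that is not allowed, so the allowed chains do not form a subcomplex. The homotopy identity
  therefore lives on all tuples modulo degenerate ones, and allowed chains enter only as submodules
  preserved by \<open>T\<close>. Cubes and paths then fit one pattern: a free module on generators
  modulo degenerate generators. The sign computations are made with integral coefficients, where no
  carrier conditions occur; an additive map carries them to any commutative ring.\<close>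

definition linear_map ::
  "('r, 'k) ring_scheme \<Rightarrow> ('r, 'm) module \<Rightarrow> ('r, 'l) module \<Rightarrow> ('m \<Rightarrow> 'l) \<Rightarrow> bool" where
  "linear_map R M N f \<longleftrightarrow>
     (\<forall>x\<in>carrier M. f x \<in> carrier N) \<and>
     (\<forall>x\<in>carrier M. \<forall>y\<in>carrier M. f (x \<oplus>\<^bsub>M\<^esub> y) = f x \<oplus>\<^bsub>N\<^esub> f y) \<and>
     (\<forall>r\<in>carrier R. \<forall>x\<in>carrier M. f (r \<odot>\<^bsub>M\<^esub> x) = r \<odot>\<^bsub>N\<^esub> f x)"

lemma linear_map_closed: "linear_map R M N f \<Longrightarrow> x \<in> carrier M \<Longrightarrow> f x \<in> carrier N"
  and linear_map_add: "linear_map R M N f \<Longrightarrow> x \<in> carrier M \<Longrightarrow> y \<in> carrier M \<Longrightarrow>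
    f (x \<oplus>\<^bsub>M\<^esub> y) = f x \<oplus>\<^bsub>N\<^esub> f y"
  and linear_map_smult: "linear_map R M N f \<Longrightarrow> r \<in> carrier R \<Longrightarrow> x \<in> carrier M \<Longrightarrow>
    f (r \<odot>\<^bsub>M\<^esub> x) = r \<odot>\<^bsub>N\<^esub> f x"
  by (simp_all add: linear_map_def)

lemma linear_map_zero:
  assumes "module R M" "module R N" "linear_map R M N f"
  shows "f \<zero>\<^bsub>M\<^esub> = \<zero>\<^bsub>N\<^esub>"
proof -
  interpret M: module R M by fact
  interpret N: module R N by fact
  have "f (\<zero>\<^bsub>R\<^esub> \<odot>\<^bsub>M\<^esub> \<zero>\<^bsub>M\<^esub>) = \<zero>\<^bsub>R\<^esub> \<odot>\<^bsub>N\<^esub> f \<zero>\<^bsub>M\<^esub>"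
    by (rule linear_map_smult[OF assms(3)]) simp_all
  then show ?thesis using linear_map_closed[OF assms(3)] by simp
qed

lemma linear_map_minus:
  assumes "module R M" "module R N" "linear_map R M N f" "x \<in> carrier M"
  shows "f (\<ominus>\<^bsub>M\<^esub> x) = \<ominus>\<^bsub>N\<^esub> f x"
proof -
  interpret M: module R M by fact
  interpret N: module R N by fact
  have "f (\<ominus>\<^bsub>M\<^esub> x) \<oplus>\<^bsub>N\<^esub> f x = f (\<ominus>\<^bsub>M\<^esub> x \<oplus>\<^bsub>M\<^esub> x)"
    using linear_map_add[OF assms(3)] assms(4) by simp
  also have "\<dots> = \<zero>\<^bsub>N\<^esub>"
    using linear_map_zero[OF assms(1-3)] assms(4) by (simp add: M.M.l_neg)
  finally show ?thesis
    using linear_map_closed[OF assms(3)] assms(4) by (simp add: N.M.minus_equality)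
qed

lemma linear_map_comp:
  "linear_map R M N f \<Longrightarrow> linear_map R N P g \<Longrightarrow> linear_map R M P (\<lambda>x. g (f x))"
  by (simp add: linear_map_def)

lemma linear_map_id: "linear_map R M M (\<lambda>x. x)"
  by (simp add: linear_map_def)

lemma linear_map_sum:
  assumes "module R N" "linear_map R M N f" "linear_map R M N g"
  shows "linear_map R M N (\<lambda>x. f x \<oplus>\<^bsub>N\<^esub> g x)"
proof -
  interpret N: module R N by fact
  have swap: "(u \<oplus>\<^bsub>N\<^esub> v) \<oplus>\<^bsub>N\<^esub> (w \<oplus>\<^bsub>N\<^esub> z) = (u \<oplus>\<^bsub>N\<^esub> w) \<oplus>\<^bsub>N\<^esub> (v \<oplus>\<^bsub>N\<^esub> z)"
    if "u \<in> carrier N" "v \<in> carrier N" "w \<in> carrier N" "z \<in> carrier N" for u v w z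
    using that by (simp add: N.M.a_ac)
  show ?thesis using assms(2,3)
    by (simp add: linear_map_def N.smult_r_distr swap)
qed

section \<open>Preimages, intersections and generation of submodules\<close>

lemma submodule_vimage:
  assumes "module R M" "module R N" "linear_map R M N f" "submodule K R N"
  shows "submodule {x \<in> carrier M. f x \<in> K} R M"
proof -
  interpret M: module R M by fact
  interpret N: module R N by fact
  note f = linear_map_zero[OF assms(1-3)] linear_map_minus[OF assms(1-3)]
    linear_map_add[OF assms(3)] linear_map_smult[OF assms(3)]
  note K = N.submoduleE[OF assms(4)]
  have "\<zero>\<^bsub>N\<^esub> \<in> K" using subgroup.one_closed[OF submodule.axioms(1)[OF assms(4)]] by simp
  then show ?thesis
    by (intro M.submoduleI) (auto simp: f intro: K)
qed

lemma submodule_Int: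
  assumes "module R M" "submodule K R M" "submodule K' R M"
  shows "submodule (K \<inter> K') R M"
proof -
  interpret M: module R M by fact
  have "\<zero>\<^bsub>M\<^esub> \<in> K" "\<zero>\<^bsub>M\<^esub> \<in> K'"
    using assms(2,3)[THEN submodule.axioms(1), THEN subgroup.one_closed] by simp_all
  then show ?thesis
    using M.submoduleE[OF assms(2)] M.submoduleE[OF assms(3)] by (intro M.submoduleI) (simp_all add: le_infI1)
qed

lemma submodule_zero:
  assumes "module R M" shows "submodule {\<zero>\<^bsub>M\<^esub>} R M"
proof -
  interpret M: module R M by fact
  show ?thesis by (rule M.submoduleI) simp_all
qed

lemma generated_submodule_incl: "X \<subseteq> generated_submodule R M X"
  by (auto simp: generated_submodule_def)

lemma generated_submodule_least:
  "submodule N R M \<Longrightarrow> X \<subseteq> N \<Longrightarrow> generated_submodule R M X \<subseteq> N"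
  by (auto simp: generated_submodule_def)

lemma generated_submodule_is_submodule:
  assumes "module R M" "X \<subseteq> carrier M"
  shows "submodule (generated_submodule R M X) R M"
proof -
  interpret M: module R M by fact
  have c: "submodule (carrier M) R M" by (rule M.carrier_is_submodule)
  show ?thesis
  proof (rule M.submoduleI)
    show "generated_submodule R M X \<subseteq> carrier M"
      by (rule generated_submodule_least[OF c assms(2)])
    show "\<zero>\<^bsub>M\<^esub> \<in> generated_submodule R M X"
      unfolding generated_submodule_def
      using submodule.axioms(1)[THEN subgroup.one_closed, of _ R M] by auto
  qed (auto simp: generated_submodule_def intro: M.submoduleE)
qed

text \<open>The preimage of \<open>K\<close> is itself a submodule, so it contains the span of
  \<open>X\<close> once it contains \<open>X\<close>. This replaces induction over linear
  combinations throughout.\<close>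

lemma linear_map_generated_submodule:
  assumes "module R M" "module R N" "linear_map R M N f" "submodule K R N"
    and "X \<subseteq> carrier M" "f ` X \<subseteq> K" "x \<in> generated_submodule R M X"
  shows "f x \<in> K"
  using generated_submodule_least[OF submodule_vimage[OF assms(1-4)], of X] assms(5-7) by blast

section \<open>Free modules and linear extensions\<close>

lemma free_module_sel [simp]:
  "\<zero>\<^bsub>free_module R S\<^esub> = (\<lambda>_. \<zero>\<^bsub>R\<^esub>)"
  "c \<oplus>\<^bsub>free_module R S\<^esub> d = (\<lambda>x. c x \<oplus>\<^bsub>R\<^esub> d x)"
  "r \<odot>\<^bsub>free_module R S\<^esub> c = (\<lambda>x. r \<otimes>\<^bsub>R\<^esub> c x)"
  by (simp_all add: free_module_def)

lemma free_module_carrierD: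
  assumes "c \<in> carrier (free_module R S)"
  shows "c x \<in> carrier R" "{x. c x \<noteq> \<zero>\<^bsub>R\<^esub>} \<subseteq> S" "finite {x. c x \<noteq> \<zero>\<^bsub>R\<^esub>}"
  using assms by (auto simp: free_module_def)

text \<open>Induction on the support, setting one coefficient to zero at a time. It allows
  statements about all chains to be checked on basis elements.\<close>

lemma free_module_generated:
  assumes "cring R"
  shows "generated_submodule R (free_module R S) (basis_elem R ` S) = carrier (free_module R S)"
proof -
  interpret R: cring R by fact
  interpret L: module R "free_module R S" by (rule free_module_is_module) fact
  let ?N = "generated_submodule R (free_module R S) (basis_elem R ` S)"
  have b: "basis_elem R ` S \<subseteq> carrier (free_module R S)"
    using basis_elem_closed[OF assms] by auto
  have N: "submodule ?N R (free_module R S)"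
    by (rule generated_submodule_is_submodule[OF L.module_axioms b])
  note NE = L.submoduleE[OF N]
  have ind: "c \<in> ?N" if "finite T" "{x. c x \<noteq> \<zero>\<^bsub>R\<^esub>} = T" "c \<in> carrier (free_module R S)" for T c
    using that
  proof (induction arbitrary: c)
    case empty
    then have "c = \<zero>\<^bsub>free_module R S\<^esub>" by auto
    then show ?case using subgroup.one_closed[OF submodule.axioms(1)[OF N]] by simp
  next
    case (insert x T)
    note cc = free_module_carrierD[OF insert.prems(2)]
    define e where "e = c(x := \<zero>\<^bsub>R\<^esub>)"
    have supp: "{y. e y \<noteq> \<zero>\<^bsub>R\<^esub>} = T"
    proof -
      have "{y. e y \<noteq> \<zero>\<^bsub>R\<^esub>} = {y. c y \<noteq> \<zero>\<^bsub>R\<^esub>} - {x}" by (auto simp: e_def)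
      then show ?thesis using insert.prems(1) insert.hyps(2) by simp
    qed
    moreover have "e \<in> carrier (free_module R S)"
    proof -
      have "e y \<in> carrier R" "y \<notin> S \<longrightarrow> e y = \<zero>\<^bsub>R\<^esub>" for y using cc(1,2) by (auto simp: e_def)
      then show ?thesis using insert.hyps(1) supp by (simp add: free_module_def)
    qed
    ultimately have en: "e \<in> ?N" by (rule insert.IH)
    have "x \<in> S" using cc(2) insert.prems(1) by blast
    then have bn: "c x \<odot>\<^bsub>free_module R S\<^esub> basis_elem R x \<in> ?N"
      using generated_submodule_incl[of "basis_elem R ` S"] by (intro NE(4) cc(1)) auto
    have "c = e \<oplus>\<^bsub>free_module R S\<^esub> (c x \<odot>\<^bsub>free_module R S\<^esub> basis_elem R x)"
      using cc(1) by (simp add: e_def basis_elem_def fun_eq_iff)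
    then show ?case using NE(5)[OF en bn] by (rule ssubst[where P = "\<lambda>u. u \<in> ?N"])
  qed
  show ?thesis
    by (intro equalityI NE(1) subsetI ind[OF _ refl]) (rule free_module_carrierD(3))
qed

text \<open>The sum in \<open>linear_extension\<close> runs over the support, which changes with
  \<open>c\<close>. Padding with zero terms puts the sums for \<open>c\<close>, \<open>d\<close> and
  \<open>c + d\<close> over one index set, as additivity requires.\<close>

lemma linear_extension_superset:
  assumes "module R M" "f \<in> S \<rightarrow> carrier M" "c \<in> carrier (free_module R S)"
    and "finite T" "{x. c x \<noteq> \<zero>\<^bsub>R\<^esub>} \<subseteq> T" "T \<subseteq> S"
  shows "linear_extension R M f c = (\<Oplus>\<^bsub>M\<^esub>x\<in>T. c x \<odot>\<^bsub>M\<^esub> f x)"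
proof -
  interpret M: module R M by fact
  note cc = free_module_carrierD[OF assms(3)]
  have "f x \<in> carrier M" if "x \<in> T" for x using that assms(2,6) by auto
  then show ?thesis unfolding linear_extension_def
    by (intro M.M.add.finprod_mono_neutral_cong_left) (use assms cc in \<open>auto\<close>)
qed

lemma linear_extension_linear:
  assumes "cring R" "module R M" "f \<in> S \<rightarrow> carrier M"
  shows "linear_map R (free_module R S) M (linear_extension R M f)"
proof -
  interpret M: module R M by fact
  interpret L: module R "free_module R S" by (rule free_module_is_module) fact
  note sup = linear_extension_superset[OF assms(2,3)]
  have f: "x \<in> S \<Longrightarrow> f x \<in> carrier M" for x using assms(3) by auto
  show ?thesis unfolding linear_map_def
  proof (intro conjI ballI)
    fix c assume c: "c \<in> carrier (free_module R S)"
    note cc = free_module_carrierD[OF c]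
    show "linear_extension R M f c \<in> carrier M"
      unfolding linear_extension_def using cc f by (intro M.M.finsum_closed) auto
    fix r assume r: "r \<in> carrier R"
    have *: "linear_extension R M f (r \<odot>\<^bsub>free_module R S\<^esub> c)
        = (\<Oplus>\<^bsub>M\<^esub>x\<in>{x. c x \<noteq> \<zero>\<^bsub>R\<^esub>}. (r \<odot>\<^bsub>free_module R S\<^esub> c) x \<odot>\<^bsub>M\<^esub> f x)"
      using cc r by (intro sup L.smult_closed[OF r c]) auto
    show "linear_extension R M f (r \<odot>\<^bsub>free_module R S\<^esub> c) = r \<odot>\<^bsub>M\<^esub> linear_extension R M f c"
      unfolding * unfolding linear_extension_def
      using cc f r
      by (subst M.finsum_smult_ldistr) (auto simp: M.smult_assoc1 subset_iff intro!: M.M.finsum_cong')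
  next
    fix c d assume c: "c \<in> carrier (free_module R S)" and d: "d \<in> carrier (free_module R S)"
    note cc = free_module_carrierD[OF c] and dd = free_module_carrierD[OF d]
    let ?T = "{x. c x \<noteq> \<zero>\<^bsub>R\<^esub>} \<union> {x. d x \<noteq> \<zero>\<^bsub>R\<^esub>}"
    have TS: "x \<in> S" if "x \<in> ?T" for x using cc dd that by auto
    have *: "linear_extension R M f (c \<oplus>\<^bsub>free_module R S\<^esub> d)
        = (\<Oplus>\<^bsub>M\<^esub>x\<in>?T. (c \<oplus>\<^bsub>free_module R S\<^esub> d) x \<odot>\<^bsub>M\<^esub> f x)"
      using cc dd by (intro sup L.M.a_closed c d) auto
    have c': "linear_extension R M f c = (\<Oplus>\<^bsub>M\<^esub>x\<in>?T. c x \<odot>\<^bsub>M\<^esub> f x)"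
      using cc dd by (intro sup c) auto
    have d': "linear_extension R M f d = (\<Oplus>\<^bsub>M\<^esub>x\<in>?T. d x \<odot>\<^bsub>M\<^esub> f x)"
      using cc dd by (intro sup d) auto
    have "(\<Oplus>\<^bsub>M\<^esub>x\<in>?T. (c x \<oplus>\<^bsub>R\<^esub> d x) \<odot>\<^bsub>M\<^esub> f x) = (\<Oplus>\<^bsub>M\<^esub>x\<in>?T. c x \<odot>\<^bsub>M\<^esub> f x \<oplus>\<^bsub>M\<^esub> d x \<odot>\<^bsub>M\<^esub> f x)"
      using cc dd f TS by (intro M.M.finsum_cong') (auto simp: M.smult_l_distr)
    also have "\<dots> = (\<Oplus>\<^bsub>M\<^esub>x\<in>?T. c x \<odot>\<^bsub>M\<^esub> f x) \<oplus>\<^bsub>M\<^esub> (\<Oplus>\<^bsub>M\<^esub>x\<in>?T. d x \<odot>\<^bsub>M\<^esub> f x)"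
      using cc dd f TS by (intro M.M.finsum_addf) auto
    finally show "linear_extension R M f (c \<oplus>\<^bsub>free_module R S\<^esub> d)
        = linear_extension R M f c \<oplus>\<^bsub>M\<^esub> linear_extension R M f d"
      unfolding * c' d' by simp
  qed
qed

lemma linear_extension_basis_elem:
  assumes "cring R" "module R M" "f \<in> S \<rightarrow> carrier M" "x \<in> S"
  shows "linear_extension R M f (basis_elem R x) = f x"
proof -
  interpret M: module R M by fact
  have fx: "f x \<in> carrier M" using assms(3,4) by auto
  have "linear_extension R M f (basis_elem R x) = (\<Oplus>\<^bsub>M\<^esub>y\<in>{x}. basis_elem R x y \<odot>\<^bsub>M\<^esub> f y)"
    using assms by (intro linear_extension_superset[OF assms(2,3)] basis_elem_closed)
      (auto simp: basis_elem_def)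
  also have "\<dots> = f x"
  proof -
    have one: "basis_elem R x x \<odot>\<^bsub>M\<^esub> f x = f x"
      using M.smult_one[OF fx] by (simp add: basis_elem_def)
    have "(\<Oplus>\<^bsub>M\<^esub>y\<in>{x}. g y) = g x" if "g x \<in> carrier M" for g
      using M.M.finsum_insert[of "{}" x g] that by simp
    from this[of "\<lambda>y. basis_elem R x y \<odot>\<^bsub>M\<^esub> f y"] show ?thesis
      using fx one by simp
  qed
  finally show ?thesis .
qed

text \<open>A chain supported in \<open>S\<close> does not see values outside \<open>S\<close>. The
  boundaries from the definitions are known to be integral chains only on genuine generators, and
  this suffices to replace them.\<close>

lemma linear_extension_cong:
  assumes "module R M" "f \<in> S \<rightarrow> carrier M" "\<And>x. x \<in> S \<Longrightarrow> f x = g x"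
    and "c \<in> carrier (free_module R S)"
  shows "linear_extension R M f c = linear_extension R M g c"
proof -
  interpret M: module R M by fact
  note cc = free_module_carrierD[OF assms(4)]
  have S: "x \<in> S" if "x \<in> {x. c x \<noteq> \<zero>\<^bsub>R\<^esub>}" for x using cc(2) that by blast
  have g: "g x \<in> carrier M" if "x \<in> S" for x
    using Pi_mem[OF assms(2) that] by (simp only: assms(3)[OF that])
  have "(\<lambda>x. c x \<odot>\<^bsub>M\<^esub> g x) \<in> {x. c x \<noteq> \<zero>\<^bsub>R\<^esub>} \<rightarrow> carrier M"
    using M.smult_closed[OF cc(1) g[OF S]] by blast
  then show ?thesis unfolding linear_extension_def
    by (rule M.M.finsum_cong'[OF refl]) (simp only: assms(3)[OF S])
qed

section \<open>Integral chains\<close>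

text \<open>The image of an integral chain under \<open>\<int>[X] \<rightarrow> R[X]\<close>.\<close>

definition frag_chain :: "('r, 'k) ring_scheme \<Rightarrow> ('x \<Rightarrow>\<^sub>0 int) \<Rightarrow> 'x \<Rightarrow> 'r" where
  "frag_chain R c = (\<lambda>x. add_pow R (Poly_Mapping.lookup c x) \<one>\<^bsub>R\<^esub>)"

lemma add_pow_int_zero: "add_pow R (0 :: int) x = \<zero>\<^bsub>R\<^esub>"
  by (simp add: add_pow_def int_pow_def)

lemma frag_chain_zero:
  assumes "cring R" shows "frag_chain R 0 = \<zero>\<^bsub>free_module R S\<^esub>"
proof -
  interpret R: cring R by fact
  show ?thesis by (simp add: frag_chain_def add_pow_int_zero)
qed

lemma frag_chain_add:
  assumes "cring R"
  shows "frag_chain R (c + d) = frag_chain R c \<oplus>\<^bsub>free_module R S\<^esub> frag_chain R d"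
proof -
  interpret R: cring R by fact
  show ?thesis by (simp add: frag_chain_def add_pow_int_zero lookup_add R.add.int_pow_mult)
qed

lemma frag_chain_frag_of:
  assumes "cring R" shows "frag_chain R (frag_of x) = basis_elem R x"
proof -
  interpret R: cring R by fact
  show ?thesis by (simp add: frag_chain_def add_pow_int_zero basis_elem_def fun_eq_iff)
qed

lemma frag_chain_closed:
  assumes "cring R" "Poly_Mapping.keys c \<subseteq> S"
  shows "frag_chain R c \<in> carrier (free_module R S)"
proof -
  interpret R: cring R by fact
  have *: "{x. frag_chain R c x \<noteq> \<zero>\<^bsub>R\<^esub>} \<subseteq> Poly_Mapping.keys c"
    by (auto simp: frag_chain_def add_pow_int_zero in_keys_iff)
  then have "finite {x. frag_chain R c x \<noteq> \<zero>\<^bsub>R\<^esub>}"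
    using finite_subset finite_keys by blast
  with * assms(2) show ?thesis
    by (auto simp: free_module_def frag_chain_def)
qed

lemma frag_chain_minus:
  assumes "cring R" "Poly_Mapping.keys c \<subseteq> S"
  shows "frag_chain R (- c) = \<ominus>\<^bsub>free_module R S\<^esub> frag_chain R c"
proof -
  interpret L: module R "free_module R S" by (rule free_module_is_module) fact
  have "frag_chain R (- c) \<oplus>\<^bsub>free_module R S\<^esub> frag_chain R c = \<zero>\<^bsub>free_module R S\<^esub>"
    using frag_chain_add[OF assms(1), of "- c" c S] frag_chain_zero[OF assms(1), of S] by simp
  then show ?thesis
    using assms by (intro L.M.minus_equality[symmetric] frag_chain_closed) (simp_all add: keys_minus)
qed

lemma frag_chain_diff:
  assumes "cring R" "Poly_Mapping.keys c \<subseteq> S" "Poly_Mapping.keys d \<subseteq> S"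
  shows "frag_chain R (c - d) = frag_chain R c \<ominus>\<^bsub>free_module R S\<^esub> frag_chain R d"
  using frag_chain_add[OF assms(1), of c "- d"] frag_chain_minus[OF assms(1,3)]
  by (simp add: a_minus_def)

text \<open>Powers of \<open>-1\<close> are the only integer scalars in the boundary formulas, so
  this is all the compatibility with scalars that is required.\<close>

lemma frag_chain_sign:
  assumes "cring R" "Poly_Mapping.keys c \<subseteq> S"
  shows "frag_chain R (frag_cmul ((-1) ^ i) c) = sign R i \<odot>\<^bsub>free_module R S\<^esub> frag_chain R c"
proof -
  interpret L: module R "free_module R S" by (rule free_module_is_module) fact
  note cl = frag_chain_closed[OF assms(1)]
  have sc: "sign R i \<in> carrier R" for i by (simp add: sign_def)
  show ?thesis
  proof (induction i)
    case 0
    show ?case using L.smult_one[OF cl[OF assms(2)]] by (simp add: sign_def)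
  next
    case (Suc i)
    have k: "Poly_Mapping.keys (frag_cmul ((-1) ^ i) c) \<subseteq> S"
      using assms(2) by auto
    have "frag_chain R (frag_cmul ((-1) ^ Suc i) c) = frag_chain R (- frag_cmul ((-1) ^ i) c)"
      by simp
    also have "\<dots> = \<ominus>\<^bsub>free_module R S\<^esub> (sign R i \<odot>\<^bsub>free_module R S\<^esub> frag_chain R c)"
      using frag_chain_minus[OF assms(1) k] by (simp only: Suc.IH)
    also have "\<dots> = (\<ominus>\<^bsub>R\<^esub> sign R i) \<odot>\<^bsub>free_module R S\<^esub> frag_chain R c"
      using L.smult_l_minus[OF sc cl[OF assms(2)]] by simp
    also have "\<ominus>\<^bsub>R\<^esub> sign R i = sign R (Suc i)"
      using sc[of i] by (simp add: sign_def L.R.r_minus)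
    finally show ?case .
  qed
qed

lemma frag_chain_sum:
  assumes "cring R" "finite I" "\<And>i. i \<in> I \<Longrightarrow> Poly_Mapping.keys (c i) \<subseteq> S"
  shows "frag_chain R (\<Sum>i\<in>I. c i) = (\<Oplus>\<^bsub>free_module R S\<^esub>i\<in>I. frag_chain R (c i))"
  using assms(2,3)
proof (induction I)
  case empty
  interpret L: module R "free_module R S" by (rule free_module_is_module) fact
  show ?case using frag_chain_zero[OF assms(1)] by simp
next
  case (insert i I)
  interpret L: module R "free_module R S" by (rule free_module_is_module) fact
  have "(\<Oplus>\<^bsub>free_module R S\<^esub>i\<in>insert i I. frag_chain R (c i))
     = frag_chain R (c i) \<oplus>\<^bsub>free_module R S\<^esub> (\<Oplus>\<^bsub>free_module R S\<^esub>i\<in>I. frag_chain R (c i))"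
    using insert.hyps frag_chain_closed[OF assms(1) insert.prems] by (intro L.M.finsum_insert) auto
  then show ?case using insert frag_chain_add[OF assms(1), of "c i" _ S] by simp
qed

text \<open>Converts a purely combinatorial bound on the keys of an integral chain into membership
  in a submodule over \<open>R\<close>. It works because a submodule is closed under differences and
  differences of generators reach every integral chain.\<close>

lemma frag_chain_in_submodule:
  assumes "cring R" "submodule K R (free_module R S)" "T \<subseteq> S"
    and "\<And>x. x \<in> T \<Longrightarrow> basis_elem R x \<in> K" "Poly_Mapping.keys c \<subseteq> T"
  shows "frag_chain R c \<in> K"
proof -
  interpret L: module R "free_module R S" by (rule free_module_is_module) fact
  note KE = L.submoduleE[OF assms(2)]
  \<comment> \<open>The bound on the keys is carried as part of the invariant: in the difference
    case \<open>frag_induction\<close> supplies only the property of \<open>a\<close> and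
    \<open>b\<close>, and \<open>frag_chain_diff\<close> needs to know their supports.\<close>
  have "frag_chain R c \<in> K \<and> Poly_Mapping.keys c \<subseteq> T"
    using assms(5)
  proof (induction c rule: frag_induction)
    case zero
    show ?case using subgroup.one_closed[OF submodule.axioms(1)[OF assms(2)]]
        frag_chain_zero[OF assms(1), of S] by simp
  next
    case (one x)
    then show ?case using assms(4) by (simp add: frag_chain_frag_of[OF assms(1)])
  next
    case (diff a b)
    have "Poly_Mapping.keys (a - b) \<subseteq> T" using keys_diff[of a b] diff by auto
    moreover have "frag_chain R (a - b) \<in> K"
      using diff assms(3) frag_chain_diff[OF assms(1), of a S b] KE by (auto simp: a_minus_def)
    ultimately show ?case by simp
  qed
  then show ?thesis ..
qed

text \<open>Both sides are additive in \<open>c\<close> and agree on generators. Hence linear maps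
  over \<open>R\<close> can be computed by \<open>frag_extend\<close> on integral chains.\<close>

lemma linear_extension_frag_chain:
  assumes "cring R" "\<And>x. x \<in> S \<Longrightarrow> Poly_Mapping.keys (F x) \<subseteq> S'" "Poly_Mapping.keys c \<subseteq> S"
  shows "linear_extension R (free_module R S') (\<lambda>x. frag_chain R (F x)) (frag_chain R c)
    = frag_chain R (frag_extend F c)"
proof -
  interpret L: module R "free_module R S" by (rule free_module_is_module) fact
  interpret L': module R "free_module R S'" by (rule free_module_is_module) fact
  let ?l = "linear_extension R (free_module R S') (\<lambda>x. frag_chain R (F x))"
  have cl: "(\<lambda>x. frag_chain R (F x)) \<in> S \<rightarrow> carrier (free_module R S')"
    using frag_chain_closed[OF assms(1,2)] by auto
  have l: "linear_map R (free_module R S) (free_module R S') ?l"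
    by (rule linear_extension_linear[OF assms(1) L'.module_axioms cl])
  have kext: "Poly_Mapping.keys (frag_extend F a) \<subseteq> S'" if "Poly_Mapping.keys a \<subseteq> S" for a
    using keys_frag_extend[of F a] assms(2) that by blast
  have "?l (frag_chain R c) = frag_chain R (frag_extend F c) \<and> Poly_Mapping.keys c \<subseteq> S"
    using assms(3)
  proof (induction c rule: frag_induction)
    case zero
    show ?case
      using linear_map_zero[OF L.module_axioms L'.module_axioms l]
        frag_chain_zero[OF assms(1), of S] frag_chain_zero[OF assms(1), of S'] by simp
  next
    case (one x)
    then show ?case
      using linear_extension_basis_elem[OF assms(1) L'.module_axioms cl one]
      by (simp add: frag_chain_frag_of[OF assms(1)])
  next
    case (diff a b)
    then have k: "Poly_Mapping.keys a \<subseteq> S" "Poly_Mapping.keys b \<subseteq> S" by auto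
    have "Poly_Mapping.keys (a - b) \<subseteq> S" using keys_diff[of a b] k by auto
    moreover have "?l (frag_chain R (a - b)) = frag_chain R (frag_extend F (a - b))"
      unfolding frag_extend_diff frag_chain_diff[OF assms(1) k]
        frag_chain_diff[OF assms(1) kext[OF k(1)] kext[OF k(2)]] a_minus_def
      using diff frag_chain_closed[OF assms(1) k(1)] frag_chain_closed[OF assms(1) k(2)]
        linear_map_add[OF l] linear_map_minus[OF L.module_axioms L'.module_axioms l]
        L.M.a_inv_closed
      by (auto simp del: free_module_sel)
    ultimately show ?case by simp
  qed
  then show ?thesis ..
qed

lemma frag_extend_fun_add:
  "frag_extend (\<lambda>x. F x + H x) c = frag_extend F c + frag_extend H c"
  by (simp add: frag_extend_def frag_cmul_distrib2 sum.distrib)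

section \<open>Quotient modules\<close>

context
  fixes R :: "('r, 'k) ring_scheme" and M :: "('r, 'm) module" and N :: "'m set"
  assumes M: "module R M" and N: "submodule N R M"
begin

interpretation M: module R M by (rule M)

interpretation N: abelian_subgroup N M
  by (rule abelian_subgroupI3)
    (auto simp: additive_subgroup_def submodule.axioms(1)[OF N] M.M.abelian_group_axioms)

lemma quotient_carrier: "carrier (quotient_module M N) = (\<lambda>x. N +>\<^bsub>M\<^esub> x) ` carrier M"
  by (auto simp: quotient_module_def A_RCOSETS_def RCOSETS_def a_r_coset_def)

lemma quotient_add:
  "x \<in> carrier M \<Longrightarrow> y \<in> carrier M \<Longrightarrow>
    (N +>\<^bsub>M\<^esub> x) \<oplus>\<^bsub>quotient_module M N\<^esub> (N +>\<^bsub>M\<^esub> y) = N +>\<^bsub>M\<^esub> (x \<oplus>\<^bsub>M\<^esub> y)"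
  by (simp add: quotient_module_def N.a_rcos_sum)

lemma coset_eq_zero_iff:
  assumes "x \<in> carrier M"
  shows "N +>\<^bsub>M\<^esub> x = \<zero>\<^bsub>quotient_module M N\<^esub> \<longleftrightarrow> x \<in> N"
  using assms N.a_rcos_self M.M.a_coset_join2[OF assms N.a_subgroup]
  by (auto simp: quotient_module_def)

lemma coset_linear: "linear_map R M (quotient_module M N) (\<lambda>x. N +>\<^bsub>M\<^esub> x)"
  by (simp add: linear_map_def quotient_carrier quotient_add quotient_smult_coset[OF M N])

lemma coset_cong:
  assumes "h \<in> N" "x \<in> carrier M"
  shows "N +>\<^bsub>M\<^esub> (h \<oplus>\<^bsub>M\<^esub> x) = N +>\<^bsub>M\<^esub> x"
  using assms by (intro N.a_repr_independence'[symmetric]) (auto simp: a_r_coset_def r_coset_def)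

lemma coset_memD: "y \<in> N +>\<^bsub>M\<^esub> x \<Longrightarrow> \<exists>h\<in>N. y = h \<oplus>\<^bsub>M\<^esub> x"
  by (auto simp: a_r_coset_def r_coset_def)

lemma coset_self: "x \<in> carrier M \<Longrightarrow> x \<in> N +>\<^bsub>M\<^esub> x"
  by (rule N.a_rcos_self)

end

text \<open>Representatives of a coset differ by elements of \<open>N\<close>, which
  \<open>f\<close> sends into \<open>N'\<close>, so all cosets in the union coincide.\<close>

lemma induced_map_coset:
  assumes M: "module R M" "submodule N R M" and M': "module R M'" "submodule N' R M'"
    and f: "linear_map R M M' f" "f ` N \<subseteq> N'" and x: "x \<in> carrier M"
  shows "induced_map M' N' f (N +>\<^bsub>M\<^esub> x) = N' +>\<^bsub>M'\<^esub> f x"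
proof -
  interpret M: module R M by fact
  have "N' +>\<^bsub>M'\<^esub> f y = N' +>\<^bsub>M'\<^esub> f x" if y: "y \<in> N +>\<^bsub>M\<^esub> x" for y
  proof -
    obtain h where h: "h \<in> N" "y = h \<oplus>\<^bsub>M\<^esub> x" using coset_memD[OF M y] by auto
    then have "h \<in> carrier M" using M.submoduleE(1)[OF M(2)] by auto
    then have "f y = f h \<oplus>\<^bsub>M'\<^esub> f x" using linear_map_add[OF f(1)] h x by simp
    then show ?thesis
      using coset_cong[OF M', of "f h" "f x"] h(1) f(2) linear_map_closed[OF f(1) x] by auto
  qed
  then show ?thesis unfolding induced_map_def using coset_self[OF M x] by blast
qed

lemma induced_map_linear:
  assumes M: "module R M" "submodule N R M" and M': "module R M'" "submodule N' R M'"
    and f: "linear_map R M M' f" "f ` N \<subseteq> N'"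
  shows "linear_map R (quotient_module M N) (quotient_module M' N') (induced_map M' N' f)"
proof -
  interpret M: module R M by fact
  note ic = induced_map_coset[OF assms] and fc = linear_map_closed[OF f(1)]
  show ?thesis unfolding linear_map_def
  proof (intro conjI ballI)
    fix X assume "X \<in> carrier (quotient_module M N)"
    then obtain x where x: "x \<in> carrier M" "X = N +>\<^bsub>M\<^esub> x"
      by (auto simp: quotient_carrier[OF M])
    show "induced_map M' N' f X \<in> carrier (quotient_module M' N')"
      using x by (simp add: ic fc quotient_carrier[OF M'])
    show "induced_map M' N' f (r \<odot>\<^bsub>quotient_module M N\<^esub> X)
        = r \<odot>\<^bsub>quotient_module M' N'\<^esub> induced_map M' N' f X" if "r \<in> carrier R" for r
      using x that by (simp add: ic fc quotient_smult_coset[OF M] quotient_smult_coset[OF M']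
          linear_map_smult[OF f(1)])
    fix Y assume "Y \<in> carrier (quotient_module M N)"
    then obtain y where y: "y \<in> carrier M" "Y = N +>\<^bsub>M\<^esub> y"
      by (auto simp: quotient_carrier[OF M])
    show "induced_map M' N' f (X \<oplus>\<^bsub>quotient_module M N\<^esub> Y)
        = induced_map M' N' f X \<oplus>\<^bsub>quotient_module M' N'\<^esub> induced_map M' N' f Y"
      using x y by (simp add: ic fc quotient_add[OF M] quotient_add[OF M'] linear_map_add[OF f(1)])
  qed
qed

section \<open>Vanishing of homology\<close>

text \<open>The modules to be compared have different types. Reducing to triviality makes each
  required isomorphism a zero map, with no composition or inversion of isomorphisms.\<close>

definition trivial_module :: "('r, 'k) ring_scheme \<Rightarrow> ('r, 'm) module \<Rightarrow> bool" where
  "trivial_module R M \<longleftrightarrow> module R M \<and> carrier M = {\<zero>\<^bsub>M\<^esub>}"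

lemma trivial_module_iso:
  assumes "trivial_module R M" "trivial_module R N"
  shows "module_iso R M N"
proof -
  interpret M: module R M using assms(1) by (simp add: trivial_module_def)
  interpret N: module R N using assms(2) by (simp add: trivial_module_def)
  have c: "carrier M = {\<zero>\<^bsub>M\<^esub>}" "carrier N = {\<zero>\<^bsub>N\<^esub>}"
    using assms by (simp_all add: trivial_module_def)
  show ?thesis unfolding module_iso_def
    by (rule bexI[of _ "\<lambda>_. \<zero>\<^bsub>N\<^esub>"]) (auto simp: c iso_def hom_def bij_betw_def)
qed

lemma trivial_zero_module:
  assumes "cring R" shows "trivial_module R zero_module"
proof -
  have "abelian_group (zero_module :: ('a, unit) module)"
    by (rule abelian_groupI) (simp_all add: zero_module_def)
  then show ?thesis unfolding trivial_module_def
    using assms by (auto intro!: moduleI simp: zero_module_def)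
qed

text \<open>When the boundaries exhaust the cycles, homology is \<open>Z / Z\<close>, whose only
  coset is its zero. The ambient \<open>M\<close> is the module whose operations the record of
  cycles inherits.\<close>

lemma trivial_homology:
  assumes "module R M" "submodule Z R M"
    and "(C n)\<lparr>carrier := {x \<in> carrier (C n). d n x = \<zero>\<^bsub>C (n - 1)\<^esub>}\<rparr> = M\<lparr>carrier := Z\<rparr>"
    and "d (Suc n) ` carrier (C (Suc n)) = Z"
  shows "trivial_module R (homology C d n)"
proof -
  let ?Z = "M\<lparr>carrier := Z\<rparr>"
  have Z: "module R ?Z" by (rule submodule.submodule_is_module[OF assms(2,1)])
  interpret Z: module R ?Z by (rule Z)
  have ZZ: "submodule Z R ?Z" using Z.carrier_is_submodule by simp
  have h: "homology C d n = quotient_module ?Z Z"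
    by (simp only: homology_def assms(3,4))
  have "carrier (quotient_module ?Z Z) = (\<lambda>x. \<zero>\<^bsub>quotient_module ?Z Z\<^esub>) ` Z"
    using coset_eq_zero_iff[OF Z ZZ] quotient_carrier[OF Z ZZ] by auto
  moreover have "Z \<noteq> {}" using Z.M.zero_closed by auto
  ultimately show ?thesis
    unfolding trivial_module_def h using quotient_module_is_module[OF Z ZZ] by auto
qed

text \<open>If \<open>d T + T d = - id\<close>, then a cycle \<open>x\<close> is the boundary of \<open>T (- x)\<close>. The operator \<open>T\<close> need not
  preserve the subcomplex \<open>K\<close>: \<open>T (- x)\<close> lies in \<open>K\<close> because its boundary is \<open>x\<close>.\<close>

lemma trivial_homology_of_contraction:
  fixes R :: "('r, 'k) ring_scheme" and Q C :: "nat \<Rightarrow> ('r, 'm) module"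
  assumes Q: "\<And>n. module R (Q n)" and A: "\<And>n. submodule (A n) R (Q n)"
    and d: "\<And>n. linear_map R (Q (Suc n)) (Q n) (d (Suc n))"
    and T: "\<And>n. linear_map R (Q n) (Q (Suc n)) (T n)"
    and TA: "\<And>n x. x \<in> A n \<Longrightarrow> T n x \<in> A (Suc n)"
    and dd: "\<And>n x. x \<in> carrier (Q (Suc (Suc n))) \<Longrightarrow> d (Suc n) (d (Suc (Suc n)) x) = \<zero>\<^bsub>Q n\<^esub>"
    and dT: "\<And>n x. x \<in> carrier (Q (Suc n)) \<Longrightarrow>
      (d (Suc (Suc n)) (T (Suc n) x) \<oplus>\<^bsub>Q (Suc n)\<^esub> T n (d (Suc n) x)) \<oplus>\<^bsub>Q (Suc n)\<^esub> x = \<zero>\<^bsub>Q (Suc n)\<^esub>"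
    and C: "\<And>n. C n = (Q n)\<lparr>carrier := K n\<rparr>"
    and K: "\<And>n. K (Suc n) = {x \<in> A (Suc n). d (Suc n) x \<in> A n}"
  shows "trivial_module R (homology C d (Suc n))"
proof -
  interpret Q0: module R "Q n" by (rule Q)
  interpret Q1: module R "Q (Suc n)" by (rule Q)
  have Ac: "A m \<subseteq> carrier (Q m)" for m by (rule module.submoduleE(1)[OF Q A])
  have A0: "\<zero>\<^bsub>Q m\<^esub> \<in> A m" for m
    using subgroup.one_closed[OF submodule.axioms(1)[OF A]] by simp
  define Z where "Z = {x \<in> A (Suc n). d (Suc n) x = \<zero>\<^bsub>Q n\<^esub>}"
  have "Z = A (Suc n) \<inter> {x \<in> carrier (Q (Suc n)). d (Suc n) x \<in> {\<zero>\<^bsub>Q n\<^esub>}}"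
    using Ac by (auto simp: Z_def)
  then have subZ: "submodule Z R (Q (Suc n))"
    using submodule_Int[OF Q A submodule_vimage[OF Q Q d submodule_zero[OF Q]]] by simp
  show ?thesis
  proof (rule trivial_homology[OF Q subZ])
    \<comment> \<open>For a cycle the clause \<open>d (Suc n) x \<in> A n\<close> in
      \<open>K\<close> is automatic, since \<open>A n\<close> contains zero; the zero of
      \<open>C n\<close> is that of \<open>Q n\<close>.\<close>
    have "{x \<in> carrier (C (Suc n)). d (Suc n) x = \<zero>\<^bsub>C (Suc n - 1)\<^esub>} = Z"
      using A0 by (auto simp: C K Z_def)
    then show "(C (Suc n))\<lparr>carrier := {x \<in> carrier (C (Suc n)). d (Suc n) x = \<zero>\<^bsub>C (Suc n - 1)\<^esub>}\<rparr>
        = (Q (Suc n))\<lparr>carrier := Z\<rparr>"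
      by (simp add: C)
    show "d (Suc (Suc n)) ` carrier (C (Suc (Suc n))) = Z"
    proof (intro equalityI subsetI)
      fix y assume "y \<in> d (Suc (Suc n)) ` carrier (C (Suc (Suc n)))"
      then show "y \<in> Z" using Ac by (auto simp: C K Z_def dd subset_iff)
    next
      fix x assume x: "x \<in> Z"
      then have xA: "x \<in> A (Suc n)" and dx: "d (Suc n) x = \<zero>\<^bsub>Q n\<^esub>" by (auto simp: Z_def)
      have xc: "x \<in> carrier (Q (Suc n))" using xA Ac by auto
      let ?x = "\<ominus>\<^bsub>Q (Suc n)\<^esub> x"
      have mA: "?x \<in> A (Suc n)" by (rule Q1.submoduleE(3)[OF A xA])
      let ?y = "T (Suc n) ?x"
      have yA: "?y \<in> A (Suc (Suc n))" by (rule TA[OF mA])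
      have dyc: "d (Suc (Suc n)) ?y \<in> carrier (Q (Suc n))"
        using yA Ac linear_map_closed[OF d] by blast
      have "d (Suc n) ?x = \<zero>\<^bsub>Q n\<^esub>"
        using linear_map_minus[OF Q Q d xc] dx by simp
      then have "T n (d (Suc n) ?x) = \<zero>\<^bsub>Q (Suc n)\<^esub>"
        using linear_map_zero[OF Q Q T] by simp
      then have "d (Suc (Suc n)) ?y \<oplus>\<^bsub>Q (Suc n)\<^esub> ?x = \<zero>\<^bsub>Q (Suc n)\<^esub>"
        using dT[of ?x n] xc dyc by simp
      then have "d (Suc (Suc n)) ?y = x"
        using Q1.M.minus_equality[OF _ _ dyc, of ?x] xc by simp
      moreover have "?y \<in> carrier (C (Suc (Suc n)))"
        using yA xA calculation by (simp add: C K)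
      ultimately show "x \<in> d (Suc (Suc n)) ` carrier (C (Suc (Suc n)))"
        by (intro image_eqI) simp_all
    qed
  qed
qed

text \<open>Generators \<open>S\<close>, degenerate generators \<open>Dg\<close>, allowed generators \<open>A\<close>, boundary \<open>B\<close> and
  contraction \<open>H\<close>. The last two take values in integral chains, which form an additive group in the
  sense of type classes; the identities between them carry over to any \<open>R\<close>. For cubical homology
  \<open>A = S\<close>; for path homology \<open>A\<close> consists of the allowed paths. \<open>bb\<close> is the boundary in terms of \<open>R\<close>.\<close>

locale contractible_generators =
  fixes R :: "('r, 'k) ring_scheme" and S Dg A :: "nat \<Rightarrow> 'x set"
    and B H :: "nat \<Rightarrow> 'x \<Rightarrow> 'x \<Rightarrow>\<^sub>0 int" and bb :: "nat \<Rightarrow> 'x \<Rightarrow> 'x \<Rightarrow> 'r"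
  assumes R: "cring R"
    and Dg_subset: "Dg n \<subseteq> S n" and A_subset: "A n \<subseteq> S n"
    and bb: "x \<in> S (Suc n) \<Longrightarrow> bb (Suc n) x = frag_chain R (B (Suc n) x)"
    and B: "x \<in> S (Suc n) \<Longrightarrow> Poly_Mapping.keys (B (Suc n) x) \<subseteq> S n"
    and B_degenerate: "x \<in> Dg (Suc n) \<Longrightarrow> Poly_Mapping.keys (B (Suc n) x) \<subseteq> Dg n"
    and B_B: "x \<in> S (Suc (Suc n)) \<Longrightarrow> frag_extend (B (Suc n)) (B (Suc (Suc n)) x) = 0"
    and H: "x \<in> S n \<Longrightarrow> Poly_Mapping.keys (H n x) \<subseteq> S (Suc n)"
    and H_degenerate: "x \<in> Dg n \<Longrightarrow> Poly_Mapping.keys (H n x) \<subseteq> Dg (Suc n)"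
    and H_A: "x \<in> A n \<Longrightarrow> Poly_Mapping.keys (H n x) \<subseteq> A (Suc n) \<union> Dg (Suc n)"
    and B_H: "x \<in> S (Suc n) \<Longrightarrow>
      Poly_Mapping.keys (frag_extend (B (Suc (Suc n))) (H (Suc n) x)
        + frag_extend (H n) (B (Suc n) x) + frag_of x) \<subseteq> Dg (Suc n)"
begin

abbreviation L where "L n \<equiv> free_module R (S n)"

abbreviation D where "D n \<equiv> generated_submodule R (L n) (basis_elem R ` Dg n)"

abbreviation Q where "Q n \<equiv> quotient_module (L n) (D n)"

abbreviation \<delta> where "\<delta> n \<equiv> linear_extension R (L (n - 1)) (bb n)"

abbreviation \<tau> where "\<tau> n \<equiv> linear_extension R (L (Suc n)) (\<lambda>x. frag_chain R (H n x))"

abbreviation d where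
  "d n \<equiv> if n = 0 then \<lambda>_. \<zero>\<^bsub>Q (n - 1)\<^esub> else induced_map (L (n - 1)) (D (n - 1)) (\<delta> n)"

abbreviation T where "T n \<equiv> induced_map (L (Suc n)) (D (Suc n)) (\<tau> n)"

abbreviation cls where "cls n x \<equiv> D n +>\<^bsub>L n\<^esub> basis_elem R x"

abbreviation AA where "AA n \<equiv> generated_submodule R (Q n) (cls n ` A n)"

section \<open>The quotient complex on the generators and its contraction\<close>

lemma L_module: "module R (L n)"
  by (rule free_module_is_module[OF R])

lemma basis_closed: "x \<in> S n \<Longrightarrow> basis_elem R x \<in> carrier (L n)"
  by (rule basis_elem_closed[OF R])

lemma D_submodule: "submodule (D n) R (L n)"
proof (rule generated_submodule_is_submodule[OF L_module image_subsetI])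
  fix x assume "x \<in> Dg n"
  then show "basis_elem R x \<in> carrier (L n)" by (rule basis_closed[OF subsetD[OF Dg_subset]])
qed

lemma Q_module: "module R (Q n)"
  by (rule quotient_module_is_module[OF L_module D_submodule])

lemma basis_in_D: "x \<in> Dg n \<Longrightarrow> basis_elem R x \<in> D n"
  by (rule subsetD[OF generated_submodule_incl imageI])

lemma frag_chain_in_D: "Poly_Mapping.keys c \<subseteq> Dg n \<Longrightarrow> frag_chain R c \<in> D n"
  by (rule frag_chain_in_submodule[OF R D_submodule Dg_subset basis_in_D])

lemma bb_closed: "bb (Suc n) \<in> S (Suc n) \<rightarrow> carrier (L n)"
proof
  fix x assume x: "x \<in> S (Suc n)"
  show "bb (Suc n) x \<in> carrier (L n)" unfolding bb[OF x] by (rule frag_chain_closed[OF R B[OF x]])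
qed

lemma \<delta>_linear: "linear_map R (L (Suc n)) (L n) (\<delta> (Suc n))"
  using linear_extension_linear[OF R L_module bb_closed] by simp

lemma \<delta>_frag_chain:
  assumes "Poly_Mapping.keys c \<subseteq> S (Suc n)"
  shows "\<delta> (Suc n) (frag_chain R c) = frag_chain R (frag_extend (B (Suc n)) c)"
  using linear_extension_cong[OF L_module bb_closed bb frag_chain_closed[OF R assms]]
    linear_extension_frag_chain[OF R B assms] by simp

lemma H_closed: "(\<lambda>x. frag_chain R (H n x)) \<in> S n \<rightarrow> carrier (L (Suc n))"
  by (rule funcsetI, rule frag_chain_closed[OF R H])

lemma \<tau>_linear: "linear_map R (L n) (L (Suc n)) (\<tau> n)"
  by (rule linear_extension_linear[OF R L_module H_closed])

lemma \<tau>_frag_chain: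
  "Poly_Mapping.keys c \<subseteq> S n \<Longrightarrow> \<tau> n (frag_chain R c) = frag_chain R (frag_extend (H n) c)"
  by (rule linear_extension_frag_chain[OF R H])

lemma \<delta>_basis: "x \<in> S (Suc n) \<Longrightarrow> \<delta> (Suc n) (basis_elem R x) = frag_chain R (B (Suc n) x)"
  using \<delta>_frag_chain[of "frag_of x" n] by (simp add: frag_chain_frag_of[OF R])

lemma \<tau>_basis: "x \<in> S n \<Longrightarrow> \<tau> n (basis_elem R x) = frag_chain R (H n x)"
  using \<tau>_frag_chain[of "frag_of x" n] by (simp add: frag_chain_frag_of[OF R])

text \<open>With \<open>N\<close> the zero submodule this proves an exact identity from its values
  on basis elements; with \<open>N = D m\<close> it proves an identity modulo degenerate
  chains.\<close>

lemma free_linear_into_submodule: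
  assumes "linear_map R (L n) (L m) f" "submodule N R (L m)"
    and "\<And>x. x \<in> S n \<Longrightarrow> f (basis_elem R x) \<in> N" "c \<in> carrier (L n)"
  shows "f c \<in> N"
proof (rule linear_map_generated_submodule[OF L_module L_module assms(1,2)])
  show "basis_elem R ` S n \<subseteq> carrier (L n)" by (rule image_subsetI, rule basis_closed)
  show "f ` basis_elem R ` S n \<subseteq> N" using assms(3) by blast
  show "c \<in> generated_submodule R (L n) (basis_elem R ` S n)"
    using assms(4) by (simp only: free_module_generated[OF R])
qed

lemma degenerate_linear_into_submodule:
  assumes "linear_map R (L n) (L m) f" "submodule N R (L m)" "\<And>x. x \<in> Dg n \<Longrightarrow> f (basis_elem R x) \<in> N"
  shows "f ` D n \<subseteq> N"
proof (rule image_subsetI, rule linear_map_generated_submodule[OF L_module L_module assms(1,2)])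
  show "basis_elem R ` Dg n \<subseteq> carrier (L n)"
    by (rule image_subsetI, rule basis_closed, rule subsetD[OF Dg_subset])
  show "f ` basis_elem R ` Dg n \<subseteq> N" using assms(3) by blast
qed

lemma \<delta>_D: "\<delta> (Suc n) ` D (Suc n) \<subseteq> D n"
proof (rule degenerate_linear_into_submodule[OF \<delta>_linear D_submodule])
  fix x assume x: "x \<in> Dg (Suc n)"
  show "\<delta> (Suc n) (basis_elem R x) \<in> D n"
    unfolding \<delta>_basis[OF subsetD[OF Dg_subset x]] by (rule frag_chain_in_D[OF B_degenerate[OF x]])
qed

lemma \<tau>_D: "\<tau> n ` D n \<subseteq> D (Suc n)"
proof (rule degenerate_linear_into_submodule[OF \<tau>_linear D_submodule])
  fix x assume x: "x \<in> Dg n"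
  show "\<tau> n (basis_elem R x) \<in> D (Suc n)"
    unfolding \<tau>_basis[OF subsetD[OF Dg_subset x]] by (rule frag_chain_in_D[OF H_degenerate[OF x]])
qed

lemma \<delta>_\<delta>:
  assumes "c \<in> carrier (L (Suc (Suc n)))"
  shows "\<delta> (Suc n) (\<delta> (Suc (Suc n)) c) = \<zero>\<^bsub>L n\<^esub>"
proof -
  have "\<delta> (Suc n) (\<delta> (Suc (Suc n)) c) \<in> {\<zero>\<^bsub>L n\<^esub>}"
  proof (rule free_linear_into_submodule[OF linear_map_comp[OF \<delta>_linear \<delta>_linear] submodule_zero[OF L_module] _ assms])
    fix x assume x: "x \<in> S (Suc (Suc n))"
    have "\<delta> (Suc n) (\<delta> (Suc (Suc n)) (basis_elem R x)) = frag_chain R 0"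
      unfolding \<delta>_basis[OF x] \<delta>_frag_chain[OF B[OF x]] B_B[OF x] ..
    then show "\<delta> (Suc n) (\<delta> (Suc (Suc n)) (basis_elem R x)) \<in> {\<zero>\<^bsub>L n\<^esub>}"
      using frag_chain_zero[OF R, of "S n"] by simp
  qed
  then show ?thesis by simp
qed

text \<open>The identity holds only up to \<open>D\<close>, because by \<open>B_H\<close> a
  degenerate remainder is left over on each generator.\<close>

lemma \<delta>_\<tau>:
  assumes "c \<in> carrier (L (Suc n))"
  shows "(\<delta> (Suc (Suc n)) (\<tau> (Suc n) c) \<oplus>\<^bsub>L (Suc n)\<^esub> \<tau> n (\<delta> (Suc n) c)) \<oplus>\<^bsub>L (Suc n)\<^esub> c \<in> D (Suc n)"
proof (rule free_linear_into_submodule[OF _ D_submodule _ assms])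
  show "linear_map R (L (Suc n)) (L (Suc n))
      (\<lambda>c. (\<delta> (Suc (Suc n)) (\<tau> (Suc n) c) \<oplus>\<^bsub>L (Suc n)\<^esub> \<tau> n (\<delta> (Suc n) c)) \<oplus>\<^bsub>L (Suc n)\<^esub> c)"
    by (intro linear_map_sum[OF L_module] linear_map_comp[OF \<tau>_linear \<delta>_linear]
        linear_map_comp[OF \<delta>_linear \<tau>_linear] linear_map_id)
  fix x assume x: "x \<in> S (Suc n)"
  have fx: "basis_elem R x = frag_chain R (frag_of x)" by (rule frag_chain_frag_of[OF R, symmetric])
  show "(\<delta> (Suc (Suc n)) (\<tau> (Suc n) (basis_elem R x)) \<oplus>\<^bsub>L (Suc n)\<^esub> \<tau> n (\<delta> (Suc n) (basis_elem R x)))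
      \<oplus>\<^bsub>L (Suc n)\<^esub> basis_elem R x \<in> D (Suc n)"
    unfolding \<delta>_basis[OF x] \<tau>_basis[OF x] \<delta>_frag_chain[OF H[OF x]] \<tau>_frag_chain[OF B[OF x]]
    \<comment> \<open>Only the last summand is still a basis element. Once it too is written as an
      integral chain, the whole expression is the image of the single integral chain in
      \<open>B_H\<close>.\<close>
    unfolding fx[THEN arg_cong[where f = "\<lambda>u. _ \<oplus>\<^bsub>L (Suc n)\<^esub> u"]] frag_chain_add[OF R, symmetric]
    by (rule frag_chain_in_D[OF B_H[OF x]])
qed

lemma d_coset: "c \<in> carrier (L (Suc n)) \<Longrightarrow> d (Suc n) (D (Suc n) +>\<^bsub>L (Suc n)\<^esub> c) = D n +>\<^bsub>L n\<^esub> \<delta> (Suc n) c"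
  using induced_map_coset[OF L_module D_submodule L_module D_submodule \<delta>_linear \<delta>_D] by simp

lemma d_linear: "linear_map R (Q (Suc n)) (Q n) (d (Suc n))"
  using induced_map_linear[OF L_module D_submodule L_module D_submodule \<delta>_linear \<delta>_D] by simp

lemma T_coset: "c \<in> carrier (L n) \<Longrightarrow> T n (D n +>\<^bsub>L n\<^esub> c) = D (Suc n) +>\<^bsub>L (Suc n)\<^esub> \<tau> n c"
  by (rule induced_map_coset[OF L_module D_submodule L_module D_submodule \<tau>_linear \<tau>_D])

lemma T_linear: "linear_map R (Q n) (Q (Suc n)) (T n)"
  by (rule induced_map_linear[OF L_module D_submodule L_module D_submodule \<tau>_linear \<tau>_D])

lemma cls_closed: "cls n ` A n \<subseteq> carrier (Q n)"
  using A_subset by (auto simp: quotient_carrier[OF L_module D_submodule] intro!: imageI basis_closed)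

lemma AA_submodule: "submodule (AA n) R (Q n)"
  by (rule generated_submodule_is_submodule[OF Q_module cls_closed])

text \<open>The degenerate terms that \<open>H_A\<close> permits vanish in the quotient. The set
  \<open>?N\<close> of chains whose class lies in \<open>AA\<close> therefore contains allowed and
  degenerate basis elements alike.\<close>

lemma T_AA:
  assumes "X \<in> AA n" shows "T n X \<in> AA (Suc n)"
proof (rule linear_map_generated_submodule[OF Q_module Q_module T_linear AA_submodule cls_closed _ assms])
  let ?N = "{c \<in> carrier (L (Suc n)). D (Suc n) +>\<^bsub>L (Suc n)\<^esub> c \<in> AA (Suc n)}"
  have N: "submodule ?N R (L (Suc n))"
    by (rule submodule_vimage[OF L_module Q_module coset_linear[OF L_module D_submodule] AA_submodule])
  have "basis_elem R y \<in> ?N" if y: "y \<in> A (Suc n) \<union> Dg (Suc n)" for y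
  proof -
    have yS: "y \<in> S (Suc n)" using y A_subset Dg_subset by blast
    have "cls (Suc n) y \<in> AA (Suc n)"
    proof (cases "y \<in> Dg (Suc n)")
      case True
      then have "cls (Suc n) y = \<zero>\<^bsub>Q (Suc n)\<^esub>"
        using coset_eq_zero_iff[OF L_module D_submodule basis_closed[OF yS]] basis_in_D by blast
      then show ?thesis using subgroup.one_closed[OF submodule.axioms(1)[OF AA_submodule]] by simp
    next
      case False
      then show ?thesis using y generated_submodule_incl[of "cls (Suc n) ` A (Suc n)"] by auto
    qed
    then show ?thesis using basis_closed[OF yS] by simp
  qed
  then have "frag_chain R (H n x) \<in> ?N" if "x \<in> A n" for x
    by (intro frag_chain_in_submodule[OF R N _ _ H_A[OF that]]) (use A_subset Dg_subset in auto)
  then show "T n ` cls n ` A n \<subseteq> AA (Suc n)"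
    using A_subset[of n] by (auto simp: T_coset \<tau>_basis basis_closed subset_iff)
qed

text \<open>\<open>K 0\<close> is left free: homology in degree \<open>Suc n\<close> uses the
  carriers in degrees \<open>Suc n\<close> and \<open>Suc (Suc n)\<close>, and takes from
  \<open>C n\<close> only its zero. The exceptional clause of \<open>path_chains\<close> in degree
  \<open>0\<close> thus never has to be matched.\<close>

lemma trivial_homology_generators:
  assumes "\<And>n. C n = (Q n)\<lparr>carrier := K n\<rparr>"
    and "\<And>n. K (Suc n) = {x \<in> AA (Suc n). d (Suc n) x \<in> AA n}"
  shows "trivial_module R (homology C d (Suc n))"
proof (rule trivial_homology_of_contraction[of R Q AA d T, OF Q_module AA_submodule d_linear T_linear T_AA _ _ assms])
  fix n X assume "X \<in> carrier (Q (Suc (Suc n)))"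
  then obtain c where c: "c \<in> carrier (L (Suc (Suc n)))" "X = D (Suc (Suc n)) +>\<^bsub>L (Suc (Suc n))\<^esub> c"
    by (auto simp: quotient_carrier[OF L_module D_submodule])
  have "d (Suc n) (d (Suc (Suc n)) X) = D n +>\<^bsub>L n\<^esub> \<zero>\<^bsub>L n\<^esub>"
    unfolding c(2) d_coset[OF c(1)] d_coset[OF linear_map_closed[OF \<delta>_linear c(1)]] \<delta>_\<delta>[OF c(1)] ..
  also have "\<dots> = \<zero>\<^bsub>Q n\<^esub>"
    by (rule linear_map_zero[OF L_module Q_module coset_linear[OF L_module D_submodule]])
  finally show "d (Suc n) (d (Suc (Suc n)) X) = \<zero>\<^bsub>Q n\<^esub>" .
next
  fix n X assume "X \<in> carrier (Q (Suc n))"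
  then obtain c where c: "c \<in> carrier (L (Suc n))" "X = D (Suc n) +>\<^bsub>L (Suc n)\<^esub> c"
    by (auto simp: quotient_carrier[OF L_module D_submodule])
  have cl: "\<tau> (Suc n) c \<in> carrier (L (Suc (Suc n)))" "\<delta> (Suc n) c \<in> carrier (L n)"
    "\<delta> (Suc (Suc n)) (\<tau> (Suc n) c) \<in> carrier (L (Suc n))" "\<tau> n (\<delta> (Suc n) c) \<in> carrier (L (Suc n))"
    using c(1) linear_map_closed[OF \<tau>_linear] linear_map_closed[OF \<delta>_linear] by blast+
  note add = quotient_add[OF L_module D_submodule] abelian_monoid.a_closed[OF abelian_group.axioms(1)[OF module.axioms(2)[OF L_module]]]
  show "(d (Suc (Suc n)) (T (Suc n) X) \<oplus>\<^bsub>Q (Suc n)\<^esub> T n (d (Suc n) X)) \<oplus>\<^bsub>Q (Suc n)\<^esub> X = \<zero>\<^bsub>Q (Suc n)\<^esub>"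
    unfolding c(2) d_coset[OF c(1)] T_coset[OF c(1)] d_coset[OF cl(1)] T_coset[OF cl(2)]
      add(1)[OF cl(3,4)] add(1)[OF add(2)[OF cl(3,4)] c(1)]
    using coset_eq_zero_iff[OF L_module D_submodule] \<delta>_\<tau>[OF c(1)] add(2)[OF add(2)[OF cl(3,4)] c(1)] by blast
qed

end

section \<open>Graph homotopies\<close>

text \<open>Homomorphisms may collapse edges, so the relation they preserve is the reflexive closure
  of adjacency.\<close>

definition near :: "'v sgraph \<Rightarrow> 'v \<Rightarrow> 'v \<Rightarrow> bool" where
  "near G u v \<longleftrightarrow> u = v \<or> {u, v} \<in> edges G"

lemma near_sym: "near G u v \<Longrightarrow> near G v u"
  by (auto simp: near_def insert_commute)

text \<open>These conditions say that \<open>f\<close> and \<open>g\<close> are the two ends of a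
  graph map from the Cartesian product of \<open>G\<close> with an edge. Only \<open>f v\<close> and
  \<open>g v\<close> at the same vertex are compared across the edge.\<close>

locale graph_homotopy =
  fixes G :: "'v sgraph" and f g :: "'v \<Rightarrow> 'v"
  assumes f_vertices: "v \<in> vertices G \<Longrightarrow> f v \<in> vertices G"
    and g_vertices: "v \<in> vertices G \<Longrightarrow> g v \<in> vertices G"
    and f_near: "u \<in> vertices G \<Longrightarrow> v \<in> vertices G \<Longrightarrow> near G u v \<Longrightarrow> near G (f u) (f v)"
    and g_near: "u \<in> vertices G \<Longrightarrow> v \<in> vertices G \<Longrightarrow> near G u v \<Longrightarrow> near G (g u) (g v)"
    and near_f_g: "v \<in> vertices G \<Longrightarrow> near G (f v) (g v)"

section \<open>Singular cubes\<close>

text \<open>A form of the distance in \<open>hypercube\<close> that decomposes along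
  \<open>#\<close> and \<open>@\<close>, as prisms and faces demand.\<close>

definition hamming :: "bool list \<Rightarrow> bool list \<Rightarrow> nat" where
  "hamming a b = length (filter (\<lambda>(x, y). x \<noteq> y) (zip a b))"

lemma hamming_sym: "hamming a b = hamming b a"
  unfolding hamming_def by (subst zip_commute) (auto simp: filter_map o_def case_prod_beta intro!: arg_cong[where f = length] filter_cong)

lemma hamming_Cons [simp]: "hamming (x # a) (y # b) = (if x = y then 0 else 1) + hamming a b"
  by (simp add: hamming_def)

lemma hamming_append: "length a = length b \<Longrightarrow> hamming (a @ a') (b @ b') = hamming a b + hamming a' b'"
  by (simp add: hamming_def)

lemma hamming_eq_0: "length a = length b \<Longrightarrow> hamming a b = 0 \<Longrightarrow> a = b"
  by (induction a b rule: list_induct2) (auto split: if_splits)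

lemma hamming_card:
  "length a = n \<Longrightarrow> length b = n \<Longrightarrow> card {i. i < n \<and> a ! i \<noteq> b ! i} = hamming a b"
  unfolding hamming_def length_filter_conv_card by (intro arg_cong[where f = card]) auto

lemma hamming_insert:
  assumes "length a = length b"
  shows "hamming (take i a @ e # drop i a) (take i b @ e # drop i b) = hamming a b"
  using hamming_append[of "take i a" "take i b" "drop i a" "drop i b"] assms
  by (simp add: hamming_append)

lemma singular_cubes_iff:
  "\<sigma> \<in> singular_cubes G n \<longleftrightarrow>
     \<sigma> \<in> {a. length a = n} \<rightarrow>\<^sub>E vertices G \<and>
     (\<forall>a b. length a = n \<longrightarrow> length b = n \<longrightarrow> hamming a b = 1 \<longrightarrow> near G (\<sigma> a) (\<sigma> b))"
proof -
  have "{u, v} \<in> edges (hypercube n) \<longleftrightarrow> length u = n \<and> length v = n \<and> hamming u v = 1" for u v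
    using hamming_card hamming_sym by (auto simp: hypercube_def doubleton_eq_iff) metis+
  then show ?thesis
    unfolding singular_cubes_def graph_hom_def near_def by (simp add: hypercube_def imp_conjL)
qed

section \<open>Faces of cubes and their commutation\<close>

lemma cube_face_Suc:
  "cube_face (Suc n) (Suc i) e \<sigma> = restrict (\<lambda>a. \<sigma> (take i a @ e # drop i a)) {a. length a = n}"
  by (simp add: cube_face_def hypercube_def)

lemma cube_face_closed:
  assumes "\<sigma> \<in> singular_cubes G (Suc n)"
  shows "cube_face (Suc n) (Suc i) e \<sigma> \<in> singular_cubes G n"
  using assms unfolding singular_cubes_iff cube_face_Suc
  by (auto simp: hamming_insert)

text \<open>Inserting \<open>d\<close> at a position \<open>j \<le> i\<close> pushes position
  \<open>i\<close> one place to the right; this is the index shift in the cubical identity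
  below.\<close>

lemma insert_insert_coordinate:
  assumes "j \<le> i" "i \<le> length a"
  shows "take (Suc i) (take j a @ d # drop j a) @ e # drop (Suc i) (take j a @ d # drop j a)
    = take j (take i a @ e # drop i a) @ d # drop j (take i a @ e # drop i a)"
  using assms by (auto simp: min_def take_drop Suc_diff_le)

lemma cube_face_commute:
  assumes "j \<le> i" "i \<le> n"
  shows "cube_face (Suc n) (Suc j) d (cube_face (Suc (Suc n)) (Suc (Suc i)) e \<sigma>)
    = cube_face (Suc n) (Suc i) e (cube_face (Suc (Suc n)) (Suc j) d \<sigma>)"
  unfolding cube_face_Suc
  using insert_insert_coordinate[OF assms(1), of _ d e] assms by (auto simp: fun_eq_iff restrict_def)

text \<open>The index pairs with first entry larger than the second are the
  \<open>(Suc i, j)\<close> with \<open>j \<le> i\<close>. They match the remaining pairs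
  \<open>(j, i)\<close>, and the hypothesis makes matched terms cancel.\<close>

lemma alternating_double_sum:
  fixes h :: "nat \<Rightarrow> nat \<Rightarrow> 'a \<Rightarrow>\<^sub>0 int"
  assumes "\<And>i j. j \<le> i \<Longrightarrow> i \<le> n \<Longrightarrow> h (Suc i) j = - h j i"
  shows "(\<Sum>i\<le>Suc n. \<Sum>j\<le>n. h i j) = 0"
proof -
  \<comment> \<open>Both halves of a column are written with indicators over the full range
    \<open>i \<le> n\<close>. The double sums then run over squares, where exchanging the order of
    summation identifies one with the other.\<close>
  have "(\<Sum>i\<le>Suc n. h i j) = (\<Sum>i\<le>n. if i \<le> j then h i j else 0) - (\<Sum>i\<le>n. if j \<le> i then h j i else 0)"
    if "j \<le> n" for j
  proof -
    have "(\<Sum>i\<le>n. if i \<le> j then h i j else 0) = (\<Sum>i\<le>j. h i j)"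
      using that by (intro sum.mono_neutral_cong_right) auto
    moreover have "(\<Sum>i\<le>n. if j \<le> i then h j i else 0) = - (\<Sum>i=j..n. h (Suc i) j)"
      unfolding sum_negf[symmetric] using that assms by (intro sum.mono_neutral_cong_right) auto
    moreover have "{..Suc n} = {..j} \<union> {Suc j..Suc n}" using that by auto
    then have "(\<Sum>i\<le>Suc n. h i j) = (\<Sum>i\<le>j. h i j) + (\<Sum>i=j..n. h (Suc i) j)"
      using sum.union_disjoint[of "{..j}" "{Suc j..Suc n}" "\<lambda>i. h i j"]
      by (simp only: sum.shift_bounds_cl_Suc_ivl) fastforce
    ultimately show ?thesis by simp
  qed
  then have "(\<Sum>i\<le>Suc n. \<Sum>j\<le>n. h i j)
      = (\<Sum>j\<le>n. \<Sum>i\<le>n. if i \<le> j then h i j else 0) - (\<Sum>j\<le>n. \<Sum>i\<le>n. if j \<le> i then h j i else 0)"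
    by (subst sum.swap) (simp add: sum_subtractf)
  also have "\<dots> = 0" by (subst sum.swap) simp
  finally show ?thesis .
qed

section \<open>The integral cubical boundary\<close>

definition cube_frag_boundary :: "nat \<Rightarrow> (bool list \<Rightarrow> 'v) \<Rightarrow> (bool list \<Rightarrow> 'v) \<Rightarrow>\<^sub>0 int" where
  "cube_frag_boundary n \<sigma> =
     (\<Sum>i\<in>{1..n}. frag_cmul ((-1) ^ i)
        (frag_of (cube_face n i False \<sigma>) - frag_of (cube_face n i True \<sigma>)))"

lemma cube_frag_boundary_Suc:
  "cube_frag_boundary (Suc n) \<sigma> =
     (\<Sum>i\<le>n. frag_cmul ((-1) ^ Suc i)
        (frag_of (cube_face (Suc n) (Suc i) False \<sigma>) - frag_of (cube_face (Suc n) (Suc i) True \<sigma>)))"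
  unfolding cube_frag_boundary_def One_nat_def sum.atLeast1_atMost_eq lessThan_Suc_atMost ..

lemma frag_extend_cube_frag_boundary:
  "frag_extend F (cube_frag_boundary (Suc n) \<sigma>) =
     (\<Sum>i\<le>n. frag_cmul ((-1) ^ Suc i)
        (F (cube_face (Suc n) (Suc i) False \<sigma>) - F (cube_face (Suc n) (Suc i) True \<sigma>)))"
  by (simp add: cube_frag_boundary_Suc frag_extend_sum frag_extend_cmul frag_extend_diff
      frag_extend_minus minus_frag_cmul[symmetric] del: minus_frag_cmul)

lemma cube_frag_boundary_boundary:
  "frag_extend (cube_frag_boundary (Suc n)) (cube_frag_boundary (Suc (Suc n)) \<sigma>) = 0"
proof -
  define F where "F i j e d = frag_of (cube_face (Suc n) (Suc j) d (cube_face (Suc (Suc n)) (Suc i) e \<sigma>))"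
    for i j e d
  define h where "h i j = frag_cmul ((-1) ^ Suc i)
      (frag_cmul ((-1) ^ Suc j) (F i j False False - F i j False True)
       - frag_cmul ((-1) ^ Suc j) (F i j True False - F i j True True))" for i j
  have "frag_extend (cube_frag_boundary (Suc n)) (cube_frag_boundary (Suc (Suc n)) \<sigma>)
      = (\<Sum>i\<le>Suc n. \<Sum>j\<le>n. h i j)"
    unfolding frag_extend_cube_frag_boundary unfolding cube_frag_boundary_Suc h_def F_def
    by (simp add: frag_cmul_sum sum_subtractf[symmetric] del: sum.atMost_Suc frag_cmul_cmul)
  also have "\<dots> = 0"
  proof (rule alternating_double_sum)
    fix i j assume "j \<le> i" "i \<le> n"
    \<comment> \<open>Commuting the two faces exchanges \<open>e\<close> and \<open>d\<close>. The
      bracket of four terms is symmetric under this exchange, so only the sign from the shift of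
      \<open>i\<close> changes.\<close>
    then have "F (Suc i) j e d = F j i d e" for e d
      unfolding F_def by (simp add: cube_face_commute)
    then show "h (Suc i) j = - h j i"
      unfolding h_def by (intro poly_mapping_eqI) (simp add: lookup_minus algebra_simps)
  qed
  finally show ?thesis .
qed

text \<open>Two equal opposite faces cancel. Excluding their directions is what makes the boundary
  of a degenerate cube degenerate, since those faces themselves may be nondegenerate.\<close>

lemma keys_cube_frag_boundary:
  "Poly_Mapping.keys (cube_frag_boundary (Suc n) \<sigma>) \<subseteq>
     (\<Union>i\<in>{i. i \<le> n \<and> cube_face (Suc n) (Suc i) True \<sigma> \<noteq> cube_face (Suc n) (Suc i) False \<sigma>}.
        \<Union>e. {cube_face (Suc n) (Suc i) e \<sigma>})"
proof -
  have "cube_frag_boundary (Suc n) \<sigma> =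
     (\<Sum>i\<in>{i. i \<le> n \<and> cube_face (Suc n) (Suc i) True \<sigma> \<noteq> cube_face (Suc n) (Suc i) False \<sigma>}.
       frag_cmul ((-1) ^ Suc i)
        (frag_of (cube_face (Suc n) (Suc i) False \<sigma>) - frag_of (cube_face (Suc n) (Suc i) True \<sigma>)))"
    unfolding cube_frag_boundary_Suc by (intro sum.mono_neutral_right) auto
  then show ?thesis
    by (simp only:, intro order_trans[OF keys_sum] UN_mono order_refl order_trans[OF keys_cmul]
        order_trans[OF keys_diff]) auto
qed

lemma keys_cube_frag_boundary_closed:
  assumes "\<sigma> \<in> singular_cubes G (Suc n)"
  shows "Poly_Mapping.keys (cube_frag_boundary (Suc n) \<sigma>) \<subseteq> singular_cubes G n"
  using keys_cube_frag_boundary[of n \<sigma>] cube_face_closed[OF assms] by blast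

lemma degenerate_cubes_Suc_iff:
  "\<sigma> \<in> degenerate_cubes G (Suc n) \<longleftrightarrow> \<sigma> \<in> singular_cubes G (Suc n) \<and>
     (\<exists>i\<le>n. cube_face (Suc n) (Suc i) True \<sigma> = cube_face (Suc n) (Suc i) False \<sigma>)"
proof -
  have "{1..Suc n} = Suc ` {..n}" by (simp add: atMost_atLeast0)
  then show ?thesis unfolding degenerate_cubes_def by auto
qed

text \<open>The direction \<open>j\<close> along which the cube is constant differs from
  \<open>i\<close>, hence survives in the face, as \<open>j\<close> itself or lowered by one. Two
  distinct directions also force \<open>n\<close> to be positive.\<close>

lemma degenerate_cube_face:
  assumes \<sigma>: "\<sigma> \<in> degenerate_cubes G (Suc n)" and i: "i \<le> n"
    and nd: "cube_face (Suc n) (Suc i) True \<sigma> \<noteq> cube_face (Suc n) (Suc i) False \<sigma>"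
  shows "cube_face (Suc n) (Suc i) e \<sigma> \<in> degenerate_cubes G n"
proof -
  obtain j where j: "j \<le> n" "cube_face (Suc n) (Suc j) True \<sigma> = cube_face (Suc n) (Suc j) False \<sigma>"
    using \<sigma> by (auto simp: degenerate_cubes_Suc_iff)
  have "i \<noteq> j" using j nd by auto
  then obtain m where m: "n = Suc m" using i j by (cases n) auto
  have face: "cube_face (Suc n) (Suc i) e \<sigma> \<in> singular_cubes G (Suc m)"
    using cube_face_closed[of \<sigma> G n] \<sigma> by (simp add: degenerate_cubes_Suc_iff m)
  show ?thesis
  proof (cases "i < j")
    case True
    then obtain k where k: "j = Suc k" by (cases j) auto
    have "cube_face (Suc m) (Suc k) d (cube_face (Suc n) (Suc i) e \<sigma>)
        = cube_face (Suc m) (Suc i) e (cube_face (Suc n) (Suc j) d \<sigma>)" for d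
      using cube_face_commute[of i k m e d \<sigma>] True j(1) by (simp add: k m)
    then show ?thesis using face j by (auto simp: m k degenerate_cubes_Suc_iff intro!: exI[of _ k])
  next
    case False
    then obtain k where k: "i = Suc k" using \<open>i \<noteq> j\<close> by (cases i) auto
    have "cube_face (Suc m) (Suc j) d (cube_face (Suc n) (Suc i) e \<sigma>)
        = cube_face (Suc m) (Suc k) e (cube_face (Suc n) (Suc j) d \<sigma>)" for d
      using cube_face_commute[of j k m d e \<sigma>] False \<open>i \<noteq> j\<close> i by (simp add: k m)
    then show ?thesis using face j False \<open>i \<noteq> j\<close> i
      by (auto simp: m degenerate_cubes_Suc_iff intro!: exI[of _ j])
  qed
qed

lemma keys_cube_frag_boundary_degenerate:
  assumes "\<sigma> \<in> degenerate_cubes G (Suc n)"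
  shows "Poly_Mapping.keys (cube_frag_boundary (Suc n) \<sigma>) \<subseteq> degenerate_cubes G n"
  using keys_cube_frag_boundary[of n \<sigma>] degenerate_cube_face[OF assms] by blast

section \<open>Images of cubes and the cubical prism\<close>

definition cube_image :: "('v \<Rightarrow> 'v) \<Rightarrow> nat \<Rightarrow> (bool list \<Rightarrow> 'v) \<Rightarrow> bool list \<Rightarrow> 'v" where
  "cube_image f n \<sigma> = restrict (\<lambda>a. f (\<sigma> a)) {a. length a = n}"

definition cube_prism :: "('v \<Rightarrow> 'v) \<Rightarrow> ('v \<Rightarrow> 'v) \<Rightarrow> nat \<Rightarrow> (bool list \<Rightarrow> 'v) \<Rightarrow> bool list \<Rightarrow> 'v" where
  "cube_prism f g n \<sigma> = restrict (\<lambda>a. (if hd a then g else f) (\<sigma> (tl a))) {a. length a = Suc n}"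

lemma cube_prism_face_1:
  "cube_face (Suc n) (Suc 0) e (cube_prism f g n \<sigma>) = cube_image (if e then g else f) n \<sigma>"
  by (auto simp: cube_face_Suc cube_prism_def cube_image_def fun_eq_iff restrict_def)

lemma cube_prism_face_Suc:
  assumes "i \<le> n"
  shows "cube_face (Suc (Suc n)) (Suc (Suc i)) e (cube_prism f g (Suc n) \<sigma>)
    = cube_prism f g n (cube_face (Suc n) (Suc i) e \<sigma>)"
proof
  fix a :: "bool list"
  show "cube_face (Suc (Suc n)) (Suc (Suc i)) e (cube_prism f g (Suc n) \<sigma>) a
    = cube_prism f g n (cube_face (Suc n) (Suc i) e \<sigma>) a"
    using assms by (cases a) (simp_all add: cube_face_Suc cube_prism_def)
qed

text \<open>The homotopy coordinate comes first, so the two ends appear in direction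
  \<open>1\<close> with sign \<open>-1\<close>, giving the \<open>g\<close> end minus the
  \<open>f\<close> end. Each direction of \<open>\<sigma>\<close> moves up by one in the prism,
  which flips its sign and cancels it against the prism over the boundary.\<close>

lemma cube_frag_boundary_prism:
  "cube_frag_boundary (Suc (Suc n)) (cube_prism f g (Suc n) \<sigma>)
     + frag_extend (\<lambda>\<sigma>. frag_of (cube_prism f g n \<sigma>)) (cube_frag_boundary (Suc n) \<sigma>)
   = frag_of (cube_image g (Suc n) \<sigma>) - frag_of (cube_image f (Suc n) \<sigma>)"
proof -
  define F where "F i = frag_of (cube_prism f g n (cube_face (Suc n) (Suc i) False \<sigma>))
     - frag_of (cube_prism f g n (cube_face (Suc n) (Suc i) True \<sigma>))" for i
  have "cube_frag_boundary (Suc (Suc n)) (cube_prism f g (Suc n) \<sigma>)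
    = frag_of (cube_image g (Suc n) \<sigma>) - frag_of (cube_image f (Suc n) \<sigma>)
      + (\<Sum>i\<le>n. frag_cmul ((-1) ^ Suc (Suc i)) (F i))"
    unfolding cube_frag_boundary_Suc[of "Suc n"] sum.atMost_Suc_shift F_def
    by (simp add: cube_prism_face_1 cube_prism_face_Suc)
  moreover have "(\<Sum>i\<le>n. frag_cmul ((-1) ^ Suc (Suc i)) (F i)) + (\<Sum>i\<le>n. frag_cmul ((-1) ^ Suc i) (F i)) = 0"
    unfolding sum.distrib[symmetric] by (intro sum.neutral) (simp add: frag_cmul_distrib[symmetric])
  moreover have "frag_extend (\<lambda>\<sigma>. frag_of (cube_prism f g n \<sigma>)) (cube_frag_boundary (Suc n) \<sigma>)
      = (\<Sum>i\<le>n. frag_cmul ((-1) ^ Suc i) (F i))"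
    unfolding frag_extend_cube_frag_boundary F_def ..
  ultimately show ?thesis by (simp only: add.assoc add_0_right)
qed

context graph_homotopy
begin

text \<open>Neighbouring points differ either in the tail only, covered by \<open>f_near\<close> and
  \<open>g_near\<close>, or in the head only, covered by \<open>near_f_g\<close>.\<close>

lemma cube_prism_closed:
  assumes "\<sigma> \<in> singular_cubes G n"
  shows "cube_prism f g n \<sigma> \<in> singular_cubes G (Suc n)"
proof -
  have V: "\<sigma> a \<in> vertices G" if "length a = n" for a
    using assms that by (auto simp: singular_cubes_iff)
  have near: "near G (\<sigma> a) (\<sigma> b)" if "length a = n" "length b = n" "hamming a b = 1" for a b
    using assms that by (auto simp: singular_cubes_iff)
  show ?thesis unfolding singular_cubes_iff
  proof (intro conjI allI impI)
    show "cube_prism f g n \<sigma> \<in> {a. length a = Suc n} \<rightarrow>\<^sub>E vertices G"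
      by (auto simp: cube_prism_def V f_vertices g_vertices)
    fix a b :: "bool list" assume ab: "length a = Suc n" "length b = Suc n" "hamming a b = 1"
    obtain x a' where a: "a = x # a'" "length a' = n" using ab(1) by (cases a) auto
    obtain y b' where b: "b = y # b'" "length b' = n" using ab(2) by (cases b) auto
    show "near G (cube_prism f g n \<sigma> a) (cube_prism f g n \<sigma> b)"
    proof (cases "x = y")
      case True
      then show ?thesis using ab(3) near[OF a(2) b(2)] f_near g_near V[OF a(2)] V[OF b(2)]
        by (simp add: a b cube_prism_def)
    next
      case False
      then have "a' = b'" using ab(3) hamming_eq_0[of a' b'] a b by simp
      then show ?thesis using False near_f_g[OF V[OF a(2)]] near_sym
        by (auto simp: a b cube_prism_def)
    qed
  qed
qed

lemma cube_prism_degenerate: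
  assumes "\<sigma> \<in> degenerate_cubes G n"
  shows "cube_prism f g n \<sigma> \<in> degenerate_cubes G (Suc n)"
proof -
  obtain m where m: "n = Suc m" using assms by (cases n) (auto simp: degenerate_cubes_def)
  obtain i where i: "i \<le> m" "cube_face n (Suc i) True \<sigma> = cube_face n (Suc i) False \<sigma>"
    using assms by (auto simp: m degenerate_cubes_Suc_iff)
  have "cube_face (Suc n) (Suc (Suc i)) True (cube_prism f g n \<sigma>)
      = cube_face (Suc n) (Suc (Suc i)) False (cube_prism f g n \<sigma>)"
    using i cube_prism_face_Suc[OF i(1), of _ f g \<sigma>] by (simp add: m)
  moreover have "\<sigma> \<in> singular_cubes G n" using assms by (simp add: degenerate_cubes_def)
  ultimately show ?thesis
    using cube_prism_closed i(1) by (auto simp: degenerate_cubes_Suc_iff m intro!: exI[of _ "Suc i"])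
qed

end

lemma cube_image_id: "\<sigma> \<in> singular_cubes G n \<Longrightarrow> cube_image (\<lambda>v. v) n \<sigma> = \<sigma>"
  by (auto simp: cube_image_def singular_cubes_iff fun_eq_iff restrict_def PiE_def extensional_def)

text \<open>Positive dimension is essential, as a \<open>0\<close>-cube has no direction in which to
  be degenerate. This is where degree \<open>0\<close> drops out of the cubical argument.\<close>

lemma cube_image_const_degenerate:
  assumes "b \<in> vertices G" shows "cube_image (\<lambda>_. b) (Suc n) \<sigma> \<in> degenerate_cubes G (Suc n)"
  unfolding degenerate_cubes_Suc_iff singular_cubes_iff
  using assms by (auto simp: cube_image_def cube_face_Suc near_def fun_eq_iff restrict_def
      split: if_splits intro!: exI[of _ 0])

section \<open>Tuples\<close>

text \<open>The cone with apex \<open>v\<close> on a simplicial chain.\<close>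

abbreviation frag_cons :: "'v \<Rightarrow> ('v list \<Rightarrow>\<^sub>0 int) \<Rightarrow> 'v list \<Rightarrow>\<^sub>0 int" where
  "frag_cons v \<equiv> frag_extend (\<lambda>q. frag_of (v # q))"

text \<open>Augmented: the boundary of a \<open>1\<close>-tuple is the empty tuple. This makes the recursion uniform.\<close>

primrec tuple_frag_boundary :: "'v list \<Rightarrow> 'v list \<Rightarrow>\<^sub>0 int" where
  "tuple_frag_boundary [] = 0"
| "tuple_frag_boundary (v # p) = frag_of p - frag_cons v (tuple_frag_boundary p)"

text \<open>The alternating sum of the tuples \<open>(f v\<^sub>0, \<dots>, f v\<^sub>i, g v\<^sub>i, \<dots>, g v\<^sub>n)\<close>.\<close>

primrec tuple_prism :: "('v \<Rightarrow> 'v) \<Rightarrow> ('v \<Rightarrow> 'v) \<Rightarrow> 'v list \<Rightarrow> 'v list \<Rightarrow>\<^sub>0 int" where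
  "tuple_prism f g [] = 0"
| "tuple_prism f g (v # p) = frag_of (f v # g v # map g p) - frag_cons (f v) (tuple_prism f g p)"

lemma keys_frag_cons: "Poly_Mapping.keys (frag_cons v c) \<subseteq> (#) v ` Poly_Mapping.keys c"
  using keys_frag_extend[of "\<lambda>q. frag_of (v # q)" c] by auto

text \<open>Boundary and prism are both defined by a recursion of this shape, so every bound on
  their supports starts here.\<close>

lemma keys_frag_of_minus_cons:
  "Poly_Mapping.keys (frag_of a - frag_cons v c) \<subseteq> insert a ((#) v ` Poly_Mapping.keys c)"
  using keys_diff[of "frag_of a" "frag_cons v c"] keys_frag_cons[of v c] by auto

lemma tuple_frag_boundary_sum:
  "tuple_frag_boundary p =
     (\<Sum>i<length p. frag_cmul ((-1) ^ i) (frag_of (take i p @ drop (Suc i) p)))"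
proof (induction p)
  case (Cons v p)
  show ?case
    unfolding tuple_frag_boundary.simps Cons.IH
    by (simp add: sum.lessThan_Suc_shift frag_extend_sum frag_extend_cmul o_def sum_negf[symmetric]
        del: sum.lessThan_Suc)
qed simp

text \<open>The cone formula. The augmentation removes the correction term that would otherwise
  appear for cones on the empty tuple.\<close>

lemma tuple_frag_boundary_cons:
  "frag_extend tuple_frag_boundary (frag_cons v c) = c - frag_cons v (frag_extend tuple_frag_boundary c)"
  using subset_UNIV
  by (induction c rule: frag_induction) (simp_all add: frag_extend_diff algebra_simps)

lemma tuple_frag_boundary_boundary: "frag_extend tuple_frag_boundary (tuple_frag_boundary p) = 0"
  by (induction p) (simp_all add: frag_extend_diff tuple_frag_boundary_cons)

lemma tuple_prism_cons:
  "frag_extend (tuple_prism f g) (frag_cons v c) =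
     frag_cons (f v) (frag_cons (g v) (frag_extend (\<lambda>q. frag_of (map g q)) c))
     - frag_cons (f v) (frag_extend (tuple_prism f g) c)"
  using subset_UNIV
proof (induction c rule: frag_induction)
  case (diff a b)
  show ?case unfolding frag_extend_diff diff.IH by (simp add: algebra_simps)
qed simp_all

lemma map_frag_cons:
  "frag_extend (\<lambda>q. frag_of (map g q)) (frag_cons v c) =
     frag_cons (g v) (frag_extend (\<lambda>q. frag_of (map g q)) c)"
  using subset_UNIV
  by (induction c rule: frag_induction) (simp_all add: frag_extend_diff)

lemma tuple_frag_boundary_map:
  "tuple_frag_boundary (map g p) = frag_extend (\<lambda>q. frag_of (map g q)) (tuple_frag_boundary p)"
  by (induction p) (simp_all add: frag_extend_diff map_frag_cons)

text \<open>Expanding by the cone formulas cancels everything except \<open>map g (v # p)\<close>,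
  minus \<open>f v # map g p\<close>, plus the cone with apex \<open>f v\<close> on the left side
  for \<open>p\<close>. By induction that cone is \<open>f v # map g p\<close> minus
  \<open>f v # map f p\<close>.\<close>

lemma tuple_frag_boundary_prism:
  "frag_extend tuple_frag_boundary (tuple_prism f g p) + frag_extend (tuple_prism f g) (tuple_frag_boundary p)
   = frag_of (map g p) - frag_of (map f p)"
proof (induction p)
  case (Cons v p)
  then have "frag_cons (f v) (frag_extend tuple_frag_boundary (tuple_prism f g p))
      + frag_cons (f v) (frag_extend (tuple_prism f g) (tuple_frag_boundary p))
      = frag_of (f v # map g p) - frag_of (f v # map f p)"
    by (simp add: frag_extend_add[symmetric] frag_extend_diff)
  then show ?case
    by (simp add: frag_extend_diff tuple_frag_boundary_cons tuple_prism_cons tuple_frag_boundary_map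
        algebra_simps)
qed simp

section \<open>Supports of the boundary and the prism of a tuple\<close>

lemma keys_tuple_frag_boundary:
  "Poly_Mapping.keys (tuple_frag_boundary p) \<subseteq> {q. Suc (length q) = length p \<and> set q \<subseteq> set p}"
proof (induction p)
  case (Cons v p)
  show ?case unfolding tuple_frag_boundary.simps
    by (rule order_trans[OF keys_frag_of_minus_cons]) (use Cons.IH in fastforce)
qed simp

text \<open>If the repetition is at the head, the two faces that destroy it are equal with opposite
  signs, and all other faces keep it. Otherwise it lies in the tail, where the induction
  applies.\<close>

lemma keys_tuple_frag_boundary_degenerate:
  "\<not> distinct_adj p \<Longrightarrow> Poly_Mapping.keys (tuple_frag_boundary p) \<subseteq> {q. \<not> distinct_adj q}"
proof (induction p rule: induct_list012)
  case (3 x y p)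
  show ?case
  proof (cases "x = y")
    case True
    then show ?thesis
      using keys_frag_cons[of x "frag_cons x (tuple_frag_boundary p)"]
        keys_frag_cons[of x "tuple_frag_boundary p"]
      by (fastforce simp: frag_extend_diff)
  next
    case False
    then have deg: "\<not> distinct_adj (y # p)" using 3(3) by simp
    show ?thesis unfolding tuple_frag_boundary.simps(2)[of x "y # p"]
      by (rule order_trans[OF keys_frag_of_minus_cons]) (use 3(2)[OF deg] deg in \<open>auto dest: distinct_adj_ConsD\<close>)
  qed
qed simp_all

text \<open>The clause on heads tells what follows a vertex put in front of \<open>q\<close>: it
  yields a repetition for degenerate tuples and nearness for paths.\<close>

lemma keys_tuple_prism:
  "Poly_Mapping.keys (tuple_prism f g p)
    \<subseteq> {q. length q = Suc (length p) \<and> set q \<subseteq> f ` set p \<union> g ` set p \<and> hd q = f (hd p)}"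
proof (induction p)
  case (Cons v p)
  show ?case unfolding tuple_prism.simps
    by (rule order_trans[OF keys_frag_of_minus_cons]) (use Cons.IH in fastforce)
qed simp

lemma not_distinct_adj_map: "\<not> distinct_adj p \<Longrightarrow> \<not> distinct_adj (map g p)"
  by (auto simp: distinct_adj_conv_nth)

text \<open>If \<open>x = y\<close>, the leading term repeats \<open>g x\<close>, and every term of
  the cone starts with \<open>f x\<close> followed by \<open>f y\<close>. Otherwise the repetition
  lies in the tail.\<close>

lemma keys_tuple_prism_degenerate:
  "\<not> distinct_adj p \<Longrightarrow> Poly_Mapping.keys (tuple_prism f g p) \<subseteq> {q. \<not> distinct_adj q}"
proof (induction p rule: induct_list012)
  case (3 x y p)
  let ?P = "tuple_prism f g"
  have keys: "Poly_Mapping.keys (?P (x # y # p))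
      \<subseteq> {f x # g x # map g (y # p)} \<union> (#) (f x) ` Poly_Mapping.keys (?P (y # p))"
    unfolding tuple_prism.simps(2)[of f g x "y # p"]
    by (rule order_trans[OF keys_frag_of_minus_cons]) simp
  show ?case
  proof (cases "x = y")
    case True
    have "Poly_Mapping.keys (?P (y # p)) \<subseteq> {q. q \<noteq> [] \<and> hd q = f y}"
      using keys_tuple_prism[of f g "y # p"] by auto
    then have "(#) (f x) ` Poly_Mapping.keys (?P (y # p)) \<subseteq> {q. \<not> distinct_adj q}"
      by (intro image_subsetI) (auto simp: distinct_adj_Cons True)
    moreover have "\<not> distinct_adj (f x # g x # map g (y # p))" by (simp add: True)
    ultimately show ?thesis by (intro order_trans[OF keys]) auto
  next
    case False
    then have deg: "\<not> distinct_adj (y # p)" using 3(3) by simp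
    show ?thesis
      by (rule order_trans[OF keys])
        (use 3(2)[OF deg] not_distinct_adj_map[OF deg, of g] in \<open>auto dest!: distinct_adj_ConsD\<close>)
  qed
qed simp_all

text \<open>Nearness and not adjacency is the invariant, because \<open>f\<close> or
  \<open>g\<close> may collapse a step of the path and \<open>f v\<close> may equal
  \<open>g v\<close>.\<close>

lemma (in graph_homotopy) keys_tuple_prism_near:
  "successively (near G) p \<Longrightarrow> set p \<subseteq> vertices G \<Longrightarrow>
    Poly_Mapping.keys (tuple_prism f g p) \<subseteq> {q. successively (near G) q}"
proof (induction p)
  case (Cons v p)
  have p: "successively (near G) p" "p \<noteq> [] \<Longrightarrow> near G v (hd p)"
    using Cons.prems(1) by (auto simp: successively_Cons)
  have v: "v \<in> vertices G" "set p \<subseteq> vertices G" using Cons.prems(2) by auto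
  have g: "successively (near G) (map g p)"
    unfolding successively_map using p(1)
    by (rule successively_mono) (use v g_near in auto)
  have "successively (near G) (f v # g v # map g p)"
    using g p(2) v g_near near_f_g by (cases p) (auto simp: successively_Cons)
  moreover have "successively (near G) (f v # q)" if q: "q \<in> Poly_Mapping.keys (tuple_prism f g p)" for q
  proof -
    have "p \<noteq> []" "hd q = f (hd p)" using q keys_tuple_prism[of f g p] by auto
    moreover from this have "near G (f v) (f (hd p))" using p(2) v f_near hd_in_set by blast
    ultimately show ?thesis
      using q Cons.IH[OF p(1) v(2)] by (auto simp: successively_Cons)
  qed
  ultimately show ?case unfolding tuple_prism.simps
    by (intro order_trans[OF keys_frag_of_minus_cons] insert_subsetI image_subsetI) simp_all
qed simp

lemma degenerate_tuples_iff:
  "p \<in> degenerate_tuples V n \<longleftrightarrow> p \<in> tuples V n \<and> \<not> distinct_adj p"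
  by (auto simp: degenerate_tuples_def tuples_def distinct_adj_conv_nth)

text \<open>Near entries that differ are adjacent, so such a tuple either has a repetition or is
  allowed. This dichotomy is the source of the union in \<open>H_A\<close>.\<close>

lemma allowed_paths_near:
  assumes "p \<in> tuples (vertices G) n" "successively (near G) p"
  shows "p \<in> allowed_paths G n \<union> degenerate_tuples (vertices G) n"
  using assms by (auto simp: degenerate_tuples_iff allowed_paths_def tuples_def near_def
      distinct_adj_conv_nth successively_conv_nth)

lemma allowed_paths_nearD: "p \<in> allowed_paths G n \<Longrightarrow> successively (near G) p"
  by (auto simp: allowed_paths_def tuples_def near_def successively_conv_nth)

section \<open>Contractible graphs\<close>

lemma cube_boundary_basis_frag_chain:
  assumes "cring R" "\<sigma> \<in> singular_cubes G (Suc n)"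
  shows "cube_boundary_basis R G (Suc n) \<sigma> = frag_chain R (cube_frag_boundary (Suc n) \<sigma>)"
proof -
  let ?L = "free_module R (singular_cubes G n)"
  interpret L: module R ?L by (rule free_module_is_module) fact
  have face: "cube_face (Suc n) i e \<sigma> \<in> singular_cubes G n" if "i \<in> {1..Suc n}" for i e
    using that cube_face_closed[OF assms(2)] by (cases i) auto
  let ?c = "\<lambda>i. frag_of (cube_face (Suc n) i False \<sigma>) - frag_of (cube_face (Suc n) i True \<sigma>)"
  have keys: "Poly_Mapping.keys (?c i) \<subseteq> singular_cubes G n" if "i \<in> {1..Suc n}" for i
    by (rule order_trans[OF keys_diff]) (simp add: face[OF that])
  have summand: "frag_chain R (frag_cmul ((-1) ^ i) (?c i)) = sign R i \<odot>\<^bsub>?L\<^esub>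
      (basis_elem R (cube_face (Suc n) i False \<sigma>) \<ominus>\<^bsub>?L\<^esub> basis_elem R (cube_face (Suc n) i True \<sigma>))"
    if i: "i \<in> {1..Suc n}" for i
    using frag_chain_sign[OF assms(1) keys[OF i]] face[OF i]
      frag_chain_diff[OF assms(1), of "frag_of (cube_face (Suc n) i False \<sigma>)" "singular_cubes G n"]
    by (simp del: free_module_sel add: frag_chain_frag_of[OF assms(1)])
  have "frag_chain R (cube_frag_boundary (Suc n) \<sigma>)
      = (\<Oplus>\<^bsub>?L\<^esub>i\<in>{1..Suc n}. frag_chain R (frag_cmul ((-1) ^ i) (?c i)))"
    unfolding cube_frag_boundary_def
    by (intro frag_chain_sum[OF assms(1)] order_trans[OF keys_cmul] keys) auto
  also have "\<dots> = (\<Oplus>\<^bsub>?L\<^esub>i\<in>{1..Suc n}. sign R i \<odot>\<^bsub>?L\<^esub>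
      (basis_elem R (cube_face (Suc n) i False \<sigma>) \<ominus>\<^bsub>?L\<^esub> basis_elem R (cube_face (Suc n) i True \<sigma>)))"
  proof (rule L.M.finsum_cong'[OF refl])
    show "(\<lambda>i. sign R i \<odot>\<^bsub>?L\<^esub>
      (basis_elem R (cube_face (Suc n) i False \<sigma>) \<ominus>\<^bsub>?L\<^esub> basis_elem R (cube_face (Suc n) i True \<sigma>)))
      \<in> {1..Suc n} \<rightarrow> carrier ?L"
    proof (rule funcsetI)
      fix i assume i: "i \<in> {1..Suc n}"
      show "sign R i \<odot>\<^bsub>?L\<^esub>
        (basis_elem R (cube_face (Suc n) i False \<sigma>) \<ominus>\<^bsub>?L\<^esub> basis_elem R (cube_face (Suc n) i True \<sigma>))
        \<in> carrier ?L"
        unfolding summand[OF i, symmetric]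
        by (rule frag_chain_closed[OF assms(1) order_trans[OF keys_cmul keys[OF i]]])
    qed
  qed (rule summand)
  finally show ?thesis by (simp add: cube_boundary_basis_def Let_def free_cubes_def)
qed

lemma contractible_generators_cubes:
  fixes G :: "'v sgraph"
  assumes R: "cring R" and H1: "graph_homotopy G (\<lambda>v. v) f" and H2: "graph_homotopy G f (\<lambda>_. b)"
    and b: "b \<in> vertices G"
  shows "contractible_generators R (singular_cubes G) (degenerate_cubes G) (singular_cubes G)
    cube_frag_boundary
    (\<lambda>n \<sigma>. frag_of (cube_prism (\<lambda>v. v) f n \<sigma>) + frag_of (cube_prism f (\<lambda>_. b) n \<sigma>))
    (cube_boundary_basis R G)"
proof (rule contractible_generators.intro)
  have keys2: "Poly_Mapping.keys (frag_of u + frag_of v) \<subseteq> {u, v}" for u v :: "bool list \<Rightarrow> 'v"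
    using keys_add[of "frag_of u" "frag_of v"] by auto
  note closed = graph_homotopy.cube_prism_closed[OF H1] graph_homotopy.cube_prism_closed[OF H2]
  note deg = graph_homotopy.cube_prism_degenerate[OF H1] graph_homotopy.cube_prism_degenerate[OF H2]
  show "cring R" by (rule R)
  fix n
  show "degenerate_cubes G n \<subseteq> singular_cubes G n" by (auto simp: degenerate_cubes_def)
  show "singular_cubes G n \<subseteq> singular_cubes G n" ..
  fix \<sigma> :: "bool list \<Rightarrow> 'v"
  {
    assume "\<sigma> \<in> singular_cubes G n"
    then show "Poly_Mapping.keys (frag_of (cube_prism (\<lambda>v. v) f n \<sigma>) + frag_of (cube_prism f (\<lambda>_. b) n \<sigma>))
        \<subseteq> singular_cubes G (Suc n)"
      by (intro order_trans[OF keys2]) (simp add: closed)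
    then show "Poly_Mapping.keys (frag_of (cube_prism (\<lambda>v. v) f n \<sigma>) + frag_of (cube_prism f (\<lambda>_. b) n \<sigma>))
        \<subseteq> singular_cubes G (Suc n) \<union> degenerate_cubes G (Suc n)"
      by (rule le_supI1)
  next
    assume "\<sigma> \<in> degenerate_cubes G n"
    then show "Poly_Mapping.keys (frag_of (cube_prism (\<lambda>v. v) f n \<sigma>) + frag_of (cube_prism f (\<lambda>_. b) n \<sigma>))
        \<subseteq> degenerate_cubes G (Suc n)"
      by (intro order_trans[OF keys2]) (simp add: deg)
  next
    assume "\<sigma> \<in> degenerate_cubes G (Suc n)"
    then show "Poly_Mapping.keys (cube_frag_boundary (Suc n) \<sigma>) \<subseteq> degenerate_cubes G n"
      by (rule keys_cube_frag_boundary_degenerate)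
  next
    show "frag_extend (cube_frag_boundary (Suc n)) (cube_frag_boundary (Suc (Suc n)) \<sigma>) = 0"
      by (rule cube_frag_boundary_boundary)
  next
    assume \<sigma>: "\<sigma> \<in> singular_cubes G (Suc n)"
    show "cube_boundary_basis R G (Suc n) \<sigma> = frag_chain R (cube_frag_boundary (Suc n) \<sigma>)"
      by (rule cube_boundary_basis_frag_chain[OF R \<sigma>])
    show "Poly_Mapping.keys (cube_frag_boundary (Suc n) \<sigma>) \<subseteq> singular_cubes G n"
      by (rule keys_cube_frag_boundary_closed[OF \<sigma>])
    let ?B = "cube_frag_boundary (Suc (Suc n))" and ?c = "cube_frag_boundary (Suc n) \<sigma>"
    have "frag_extend ?B (frag_of (cube_prism (\<lambda>v. v) f (Suc n) \<sigma>) + frag_of (cube_prism f (\<lambda>_. b) (Suc n) \<sigma>))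
      + frag_extend (\<lambda>\<sigma>. frag_of (cube_prism (\<lambda>v. v) f n \<sigma>) + frag_of (cube_prism f (\<lambda>_. b) n \<sigma>)) ?c
      + frag_of \<sigma>
      = (?B (cube_prism (\<lambda>v. v) f (Suc n) \<sigma>) + frag_extend (\<lambda>\<sigma>. frag_of (cube_prism (\<lambda>v. v) f n \<sigma>)) ?c)
      + (?B (cube_prism f (\<lambda>_. b) (Suc n) \<sigma>) + frag_extend (\<lambda>\<sigma>. frag_of (cube_prism f (\<lambda>_. b) n \<sigma>)) ?c)
      + frag_of \<sigma>"
      by (simp add: frag_extend_add frag_extend_fun_add)
    \<comment> \<open>The two homotopies telescope: (image under \<open>f\<close> minus
      \<open>\<sigma>\<close>) plus (constant minus image under \<open>f\<close>) plus
      \<open>\<sigma>\<close> leaves the constant cube.\<close>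
    also have "\<dots> = frag_of (cube_image (\<lambda>_. b) (Suc n) \<sigma>)"
      unfolding cube_frag_boundary_prism cube_image_id[OF \<sigma>] by simp
    finally show "Poly_Mapping.keys (frag_extend ?B
          (frag_of (cube_prism (\<lambda>v. v) f (Suc n) \<sigma>) + frag_of (cube_prism f (\<lambda>_. b) (Suc n) \<sigma>))
        + frag_extend (\<lambda>\<sigma>. frag_of (cube_prism (\<lambda>v. v) f n \<sigma>) + frag_of (cube_prism f (\<lambda>_. b) n \<sigma>)) ?c
        + frag_of \<sigma>) \<subseteq> degenerate_cubes G (Suc n)"
      using cube_image_const_degenerate[OF b, of n \<sigma>] by simp
  }
qed

lemma trivial_cube_homology:
  assumes "cring R" "graph_homotopy G (\<lambda>v. v) f" "graph_homotopy G f (\<lambda>_. b)" "b \<in> vertices G" "0 < n"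
  shows "trivial_module R (cube_homology R G n)"
proof -
  interpret contractible_generators R "singular_cubes G" "degenerate_cubes G" "singular_cubes G"
    cube_frag_boundary
    "\<lambda>n \<sigma>. frag_of (cube_prism (\<lambda>v. v) f n \<sigma>) + frag_of (cube_prism f (\<lambda>_. b) n \<sigma>)"
    "cube_boundary_basis R G"
    by (rule contractible_generators_cubes[OF assms(1-4)])
  have C: "cube_chains R G = Q" and d: "cube_boundary R G = d"
    by (simp_all add: fun_eq_iff cube_chains_def cube_boundary_def degenerate_cube_chains_def free_cubes_def)
  \<comment> \<open>Here every cube counts as allowed, and classes of cubes span the quotient. The
    condition on boundaries is then vacuous, and the subcomplex is the whole complex.\<close>
  have AA_carrier: "AA n = carrier (Q n)" for n
  proof
    show "AA n \<subseteq> carrier (Q n)" by (rule module.submoduleE(1)[OF Q_module AA_submodule])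
    have "D n +>\<^bsub>L n\<^esub> c \<in> AA n" if "c \<in> carrier (L n)" for c
    proof -
      have "c \<in> {c \<in> carrier (L n). D n +>\<^bsub>L n\<^esub> c \<in> AA n}"
        by (rule free_linear_into_submodule[OF linear_map_id
              submodule_vimage[OF L_module Q_module coset_linear[OF L_module D_submodule] AA_submodule] _ that])
          (auto intro: basis_closed subsetD[OF generated_submodule_incl])
      then show ?thesis by simp
    qed
    then show "carrier (Q n) \<subseteq> AA n" by (auto simp: quotient_carrier[OF L_module D_submodule])
  qed
  obtain m where m: "n = Suc m" using assms(5) by (cases n) auto
  show ?thesis unfolding m cube_homology_def C d
  proof (rule trivial_homology_generators)
    show "Q n = (Q n)\<lparr>carrier := carrier (Q n)\<rparr>" for n by simp
    show "carrier (Q (Suc n)) = {x \<in> AA (Suc n). d (Suc n) x \<in> AA n}" for n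
      unfolding AA_carrier using linear_map_closed[OF d_linear] by blast
  qed
qed

section \<open>Vanishing of path homology\<close>

lemma tuple_boundary_basis_frag_chain:
  assumes "cring R" "p \<in> tuples V (Suc n)"
  shows "tuple_boundary_basis R V (Suc n) p = frag_chain R (tuple_frag_boundary p)"
proof -
  let ?L = "free_module R (tuples V n)"
  interpret L: module R ?L by (rule free_module_is_module) fact
  let ?c = "\<lambda>i. frag_of (take i p @ drop (Suc i) p)"
  have keys: "Poly_Mapping.keys (?c i) \<subseteq> tuples V n" if "i \<in> {0..Suc n}" for i
    using assms(2) that set_take_subset[of i p] set_drop_subset[of "Suc i" p] by (auto simp: tuples_def)
  have summand: "frag_chain R (frag_cmul ((-1) ^ i) (?c i))
      = sign R i \<odot>\<^bsub>?L\<^esub> basis_elem R (take i p @ drop (Suc i) p)" if i: "i \<in> {0..Suc n}" for i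
    using frag_chain_sign[OF assms(1) keys[OF i]] by (simp only: frag_chain_frag_of[OF assms(1)])
  have range: "{..<length p} = {0..Suc n}" using assms(2) by (auto simp: tuples_def)
  have "frag_chain R (tuple_frag_boundary p)
      = (\<Oplus>\<^bsub>?L\<^esub>i\<in>{0..Suc n}. frag_chain R (frag_cmul ((-1) ^ i) (?c i)))"
    unfolding tuple_frag_boundary_sum range
    by (intro frag_chain_sum[OF assms(1)] order_trans[OF keys_cmul] keys) auto
  also have "\<dots> = (\<Oplus>\<^bsub>?L\<^esub>i\<in>{0..Suc n}. sign R i \<odot>\<^bsub>?L\<^esub> basis_elem R (take i p @ drop (Suc i) p))"
  proof (rule L.M.finsum_cong'[OF refl])
    show "(\<lambda>i. sign R i \<odot>\<^bsub>?L\<^esub> basis_elem R (take i p @ drop (Suc i) p)) \<in> {0..Suc n} \<rightarrow> carrier ?L"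
    proof (rule funcsetI)
      fix i assume i: "i \<in> {0..Suc n}"
      show "sign R i \<odot>\<^bsub>?L\<^esub> basis_elem R (take i p @ drop (Suc i) p) \<in> carrier ?L"
        unfolding summand[OF i, symmetric]
        by (rule frag_chain_closed[OF assms(1) order_trans[OF keys_cmul keys[OF i]]])
    qed
  qed (rule summand)
  finally show ?thesis by (simp add: tuple_boundary_basis_def Let_def free_tuples_def)
qed

text \<open>The augmentation of \<open>tuple_frag_boundary\<close> does no harm: the locale refers
  to \<open>B\<close> only at indices \<open>Suc n\<close>, that is, on tuples with at least two
  entries.\<close>

lemma contractible_generators_tuples:
  fixes G :: "'v sgraph"
  assumes R: "cring R" and H1: "graph_homotopy G (\<lambda>v. v) f" and H2: "graph_homotopy G f (\<lambda>_. b)"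
    and b: "b \<in> vertices G"
  shows "contractible_generators R (tuples (vertices G)) (degenerate_tuples (vertices G)) (allowed_paths G)
    (\<lambda>_. tuple_frag_boundary) (\<lambda>_ p. tuple_prism (\<lambda>v. v) f p + tuple_prism f (\<lambda>_. b) p)
    (tuple_boundary_basis R (vertices G))"
proof (rule contractible_generators.intro)
  let ?V = "vertices G"
  let ?P = "tuple_prism (\<lambda>v. v) f" and ?P' = "tuple_prism f (\<lambda>_. b)"
  have fV: "f v \<in> ?V" if "v \<in> ?V" for v by (rule graph_homotopy.f_vertices[OF H2 that])
  have keys: "q \<in> Poly_Mapping.keys (?P p) \<or> q \<in> Poly_Mapping.keys (?P' p)"
    if "q \<in> Poly_Mapping.keys (?P p + ?P' p)" for p q
    using that keys_add[of "?P p" "?P' p"] by auto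
  have closed: "Poly_Mapping.keys (?P p + ?P' p) \<subseteq> tuples ?V (Suc n)" if "p \<in> tuples ?V n" for p n
  proof
    fix q assume "q \<in> Poly_Mapping.keys (?P p + ?P' p)"
    then have "length q = Suc (length p) \<and> set q \<subseteq> set p \<union> f ` set p \<union> (\<lambda>_. b) ` set p"
      using keys[of q p] keys_tuple_prism[of "\<lambda>v. v" f p] keys_tuple_prism[of f "\<lambda>_. b" p] by auto
    then show "q \<in> tuples ?V (Suc n)" using that fV b by (auto simp: tuples_def subset_iff)
  qed
  show "cring R" by (rule R)
  fix n
  show "degenerate_tuples ?V n \<subseteq> tuples ?V n" by (auto simp: degenerate_tuples_def)
  show "allowed_paths G n \<subseteq> tuples ?V n" by (auto simp: allowed_paths_def)
  fix p :: "'v list"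
  show "frag_extend tuple_frag_boundary (tuple_frag_boundary p) = 0"
    by (rule tuple_frag_boundary_boundary)
  {
    assume "p \<in> tuples ?V n"
    then show "Poly_Mapping.keys (?P p + ?P' p) \<subseteq> tuples ?V (Suc n)" by (rule closed)
  next
    assume p: "p \<in> degenerate_tuples ?V n"
    then have d: "p \<in> tuples ?V n" "\<not> distinct_adj p" by (simp_all add: degenerate_tuples_iff)
    show "Poly_Mapping.keys (?P p + ?P' p) \<subseteq> degenerate_tuples ?V (Suc n)"
    proof
      fix q assume q: "q \<in> Poly_Mapping.keys (?P p + ?P' p)"
      have "\<not> distinct_adj q"
        using keys[OF q] keys_tuple_prism_degenerate[OF d(2)] by blast
      then show "q \<in> degenerate_tuples ?V (Suc n)"
        using subsetD[OF closed[OF d(1)] q] by (simp add: degenerate_tuples_iff)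
    qed
  next
    assume p: "p \<in> allowed_paths G n"
    then have pt: "p \<in> tuples ?V n" by (simp add: allowed_paths_def)
    then have pV: "set p \<subseteq> ?V" by (simp add: tuples_def)
    show "Poly_Mapping.keys (?P p + ?P' p) \<subseteq> allowed_paths G (Suc n) \<union> degenerate_tuples ?V (Suc n)"
    proof
      fix q assume q: "q \<in> Poly_Mapping.keys (?P p + ?P' p)"
      have "successively (near G) q"
        using keys[OF q] graph_homotopy.keys_tuple_prism_near[OF H1 allowed_paths_nearD[OF p] pV]
          graph_homotopy.keys_tuple_prism_near[OF H2 allowed_paths_nearD[OF p] pV] by blast
      then show "q \<in> allowed_paths G (Suc n) \<union> degenerate_tuples ?V (Suc n)"
        using closed[OF pt] q by (intro allowed_paths_near) auto
    qed
  next
    assume p: "p \<in> degenerate_tuples ?V (Suc n)"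
    then have "\<not> distinct_adj p" "p \<in> tuples ?V (Suc n)" by (simp_all add: degenerate_tuples_iff)
    then show "Poly_Mapping.keys (tuple_frag_boundary p) \<subseteq> degenerate_tuples ?V n"
      using keys_tuple_frag_boundary_degenerate[of p] keys_tuple_frag_boundary[of p]
      by (auto simp: degenerate_tuples_iff tuples_def subset_iff)
  next
    assume p: "p \<in> tuples ?V (Suc n)"
    show "tuple_boundary_basis R ?V (Suc n) p = frag_chain R (tuple_frag_boundary p)"
      by (rule tuple_boundary_basis_frag_chain[OF R p])
    show "Poly_Mapping.keys (tuple_frag_boundary p) \<subseteq> tuples ?V n"
      using keys_tuple_frag_boundary[of p] p by (auto simp: tuples_def subset_iff)
    have "frag_extend tuple_frag_boundary (?P p + ?P' p)
        + frag_extend (\<lambda>p. ?P p + ?P' p) (tuple_frag_boundary p) + frag_of p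
      = (frag_extend tuple_frag_boundary (?P p) + frag_extend ?P (tuple_frag_boundary p))
        + (frag_extend tuple_frag_boundary (?P' p) + frag_extend ?P' (tuple_frag_boundary p)) + frag_of p"
      by (simp add: frag_extend_add frag_extend_fun_add)
    \<comment> \<open>The same telescoping as for cubes. Since \<open>p\<close> has at least two
      entries, the constant tuple that remains begins with a repetition.\<close>
    also have "\<dots> = frag_of (map (\<lambda>_. b) p)"
      unfolding tuple_frag_boundary_prism by simp
    finally show "Poly_Mapping.keys (frag_extend tuple_frag_boundary (?P p + ?P' p)
        + frag_extend (\<lambda>p. ?P p + ?P' p) (tuple_frag_boundary p) + frag_of p) \<subseteq> degenerate_tuples ?V (Suc n)"
      using p b by (auto simp: degenerate_tuples_def tuples_def)
  }
qed

lemma trivial_path_homology: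
  assumes "cring R" "graph_homotopy G (\<lambda>v. v) f" "graph_homotopy G f (\<lambda>_. b)" "b \<in> vertices G" "0 < n"
  shows "trivial_module R (path_homology R G n)"
proof -
  interpret contractible_generators R "tuples (vertices G)" "degenerate_tuples (vertices G)" "allowed_paths G"
    "\<lambda>_. tuple_frag_boundary" "\<lambda>_ p. tuple_prism (\<lambda>v. v) f p + tuple_prism f (\<lambda>_. b) p"
    "tuple_boundary_basis R (vertices G)"
    by (rule contractible_generators_tuples[OF assms(1-4)])
  have Qd: "tuple_chains R (vertices G) = Q" and d: "tuple_boundary R (vertices G) = d"
    by (simp_all add: fun_eq_iff tuple_chains_def tuple_boundary_def degenerate_tuple_chains_def free_tuples_def)
  have A: "allowed_chains R G n = AA n" for n
    by (simp add: allowed_chains_def tuple_class_def[abs_def] tuple_chains_def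
        degenerate_tuple_chains_def free_tuples_def)
  obtain m where m: "n = Suc m" using assms(5) by (cases n) auto
  show ?thesis unfolding m path_homology_def d
  proof (rule trivial_homology_generators)
    show "path_chains R G n = (Q n)\<lparr>carrier := {x \<in> AA n. d n x \<in>
        (if n = 0 then {\<zero>\<^bsub>Q (n - 1)\<^esub>} else AA (n - 1))}\<rparr>" for n
      unfolding path_chains_def Qd d A ..
  qed simp
qed

theorem theorem4p4:
  fixes R :: "('r, 'k) ring_scheme"
    and G K1 K2 :: "'v sgraph"
    and a b :: 'v
  assumes "cring R"
    and "finite_simple_graph G"
    and "induced_subgraph K1 G" and "induced_subgraph K2 G"
    and "vertices K1 \<noteq> {}" and "vertices K2 \<noteq> {}"
    and "vertices G = vertices K1 \<union> vertices K2"
    and "vertices K1 \<inter> vertices K2 = {}"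
    and "a \<in> vertices K1" and "b \<in> vertices K2"
    and "{a, b} \<in> edges G"
    and "\<forall>v\<in>vertices K1. {v, b} \<in> edges G"
    and "\<forall>v\<in>vertices K2. {v, a} \<in> edges G"
  shows "\<forall>n>0. module_iso R (path_homology R G n) (cube_homology R G n) \<and>
               module_iso R (cube_homology R G n) zero_module"
proof -
  define f where "f v = (if v \<in> vertices K1 then b else a)" for v
  have ab: "a \<in> vertices G" "b \<in> vertices G" "near G a b" "near G b a"
    using assms(7,9-11) by (auto simp: near_def insert_commute)
  have near_f: "near G (f u) (f v)" for u v
    using ab by (auto simp: f_def near_def)
  have near_id: "near G v (f v)" if "v \<in> vertices G" for v
    using that assms(7,12,13) by (auto simp: f_def near_def)
  have near_b: "near G (f v) b" for v
    using ab by (auto simp: f_def near_def)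
  have H1: "graph_homotopy G (\<lambda>v. v) f"
    by standard (use near_f near_id ab in \<open>auto simp: f_def\<close>)
  have H2: "graph_homotopy G f (\<lambda>_. b)"
    by standard (use near_f near_b ab in \<open>auto simp: f_def near_def\<close>)
  note trivial = trivial_path_homology[OF assms(1) H1 H2 ab(2)] trivial_cube_homology[OF assms(1) H1 H2 ab(2)]
  show ?thesis
    using trivial by (blast intro: trivial_module_iso trivial_zero_module[OF assms(1)])
qed

end
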